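(* Let $\mu$ and $\nu$ be finite Borel measures on a complete separable metric space $Z$. (i) For $\epsilon\ge0$, $d_P(\mu,\nu)\le\epsilon$ if and only if there is a Borel measure $\alpha$ on $Z\times Z$ such that $D(\alpha;\mu,\nu)+\alpha(\{(x,y):d(x,y)>\epsilon\})\le\epsilon$. (ii) Equivalently, $d_P(\mu,\nu)=\min\{\epsilon\ge0:\exists\alpha:\ D(\alpha;\mu,\nu)+\alpha(\{(x,y):d(x,y)>\epsilon\})\le\epsilon\}$, and the minimum is attained. (iii) In addition, if $\mu(Z)\le\nu(Z)$, then the minimum in (ii) is attained for $\epsilon:=d_P(\mu,\nu)$ and some $\alpha$ with $\pi_{1*}\alpha=\mu$ and $\pi_{2*}\alpha\le\nu$; moreover $\alpha$ can be chosen to be supported on $\mathrm{supp}(\mu)\times\mathrm{supp}(\nu)$.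
   Context: For a closed set $A\subseteq Z$ and $\epsilon\ge0$, $A^\epsilon=\{z\in Z:\exists a\in A,\ d(z,a)\le\epsilon\}$. The Prokhorov distance is $d_P(\mu,\nu)=\inf\{\epsilon>0: \mu(A)\le\nu(A^\epsilon)+\epsilon \text{ and } \nu(A)\le\mu(A^\epsilon)+\epsilon \text{ for all closed } A\subseteq Z\}$. $\pi_1,\pi_2$ are the projections of $Z\times Z$ onto its factors and $f_*$ denotes push-forward. The total variation distance of measures is $\|\mu-\nu\|_{TV}=\sup_A|\mu(A)-\nu(A)|$ over Borel sets $A$. For a finite Borel measure $\alpha$ on $Z\times Z$, the discrepancy is $D(\alpha;\mu,\nu):=\|\pi_{1*}\alpha-\mu\|_{TV}+\|\pi_{2*}\alpha-\nu\|_{TV}$. *)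

theory Defs
  imports "HOL-Analysis.Analysis"
begin

definition cthick :: "'a::metric_space set \<Rightarrow> real \<Rightarrow> 'a set" where
  "cthick A e = {z. \<exists>a\<in>A. dist z a \<le> e}"

definition finite_borel_measure :: "'a::topological_space measure \<Rightarrow> bool" where
  "finite_borel_measure M \<longleftrightarrow> sets M = sets borel \<and> finite_measure M"

text \<open>Prokhorov distance. The enlargement of a closed set is in general only
  universally measurable (analytic), so it is measured with the completion of the
  measure (which agrees with the measure on Borel sets).\<close>
definition prokhorov_dist :: "'a::metric_space measure \<Rightarrow> 'a measure \<Rightarrow> real" where
  "prokhorov_dist \<mu> \<nu> = Inf {e. e > 0 \<and> (\<forall>A. closed A \<longrightarrow>
       measure \<mu> A \<le> measure (completion \<nu>) (cthick A e) + e \<and>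
       measure \<nu> A \<le> measure (completion \<mu>) (cthick A e) + e)}"

definition tv_dist :: "'a::topological_space measure \<Rightarrow> 'a measure \<Rightarrow> real" where
  "tv_dist \<mu> \<nu> = (SUP A\<in>sets borel. \<bar>measure \<mu> A - measure \<nu> A\<bar>)"

definition discrepancy :: "('a::topological_space \<times> 'a) measure \<Rightarrow> 'a measure \<Rightarrow> 'a measure \<Rightarrow> real" where
  "discrepancy \<alpha> \<mu> \<nu> = tv_dist (distr \<alpha> borel fst) \<mu> + tv_dist (distr \<alpha> borel snd) \<nu>"

definition msupp :: "'a::metric_space measure \<Rightarrow> 'a set" where
  "msupp M = {z. \<forall>r>0. emeasure M (ball z r) > 0}"

definition coupling_ok :: "('a::metric_space \<times> 'a) measure \<Rightarrow> 'a measure \<Rightarrow> 'a measure \<Rightarrow> real \<Rightarrow> bool" where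
  "coupling_ok \<alpha> \<mu> \<nu> e \<longleftrightarrow>
     discrepancy \<alpha> \<mu> \<nu> + measure \<alpha> {(x, y). dist x y > e} \<le> e"

end

theory Submission
  imports Defs
begin

text \<open>
  The hard direction produces a coupling at \<open>d = prokhorov_dist \<mu> \<nu>\<close> when \<open>\<mu>\<close> has the smaller mass.
  Let \<open>S = {(x, y). dist x y \<le> d}\<close>. For every finite family of Borel sets, a weighted Hall theorem on
  its atoms gives a finitely supported measure whose marginals are below \<open>\<mu>\<close> and \<open>\<nu>\<close> on the family,
  which charges only pairs of atoms meeting \<open>S\<close>, and whose mass is at least \<open>\<nu>(Z) - d\<close>. Tychonoff's
  theorem yields a finitely additive set function with these properties for all Borel sets at once.
  Since its marginals are dominated by tight measures, Caratheodory's theorem turns it into a measure,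
  concentrated on \<open>S\<close>. The unmatched mass of \<open>\<mu>\<close> is distributed by a multiple of the product of the
  two remainders.

  In the converse direction the thickening of a closed set is the projection of a closed set, hence
  universally measurable, so that its completed measure is not the junk value \<open>0\<close>.
\<close>

section \<open>A weighted Hall theorem\<close>

text \<open>The limit is arranged so that no weak convergence enters. Vanishing on rectangles that
  miss \<open>S\<close> refers to the exact radius \<open>d\<close>; like domination by \<mu> and
  \<nu>, it constrains only finitely many values of a set function at a time, so it survives a
  pointwise limit. The price is that countable additivity is lost in the limit and must be recovered
  from tightness.

  Attainment at \<open>d\<close> itself rests on compact sets. An infimum of admissible radii is not
  visibly admissible for every closed set, but for compact \<open>K\<close> the thickenings of
  radius \<open>d + 1/n\<close> decrease to the one of radius \<open>d\<close>, and inner regularity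
  carries the inequality from compact to Borel sets. The deficit \<open>d\<close> is measured
  against \<nu>(Z), the larger mass, because discrepancy and mass off \<open>S\<close> together
  amount to at most \<nu>(Z) minus the matched mass.\<close>

lemma weighted_hall:
  fixes a :: "'i \<Rightarrow> real" and b :: "'j \<Rightarrow> real" and R :: "'i \<Rightarrow> 'j \<Rightarrow> bool"
  assumes "finite I" "finite J"
    and "\<And>i. i \<in> I \<Longrightarrow> 0 \<le> a i" "\<And>j. j \<in> J \<Longrightarrow> 0 \<le> b j"
    and "\<And>K. K \<subseteq> J \<Longrightarrow> sum b K \<le> sum a {i\<in>I. \<exists>j\<in>K. R i j}"
  shows "\<exists>x. (\<forall>i j. 0 \<le> x i j) \<and> (\<forall>i j. x i j \<noteq> 0 \<longrightarrow> i \<in> I \<and> j \<in> J \<and> R i j)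
           \<and> (\<forall>i\<in>I. (\<Sum>j\<in>J. x i j) \<le> a i) \<and> (\<forall>j\<in>J. (\<Sum>i\<in>I. x i j) = b j)"
    (is "\<exists>x. ?sol I J a b x")
  using assms
\<comment> \<open>Real weights offer no integer to decrease, so the induction counts vertices on
  both sides and leaves the weights arbitrary.\<close>
proof (induction "card I + card J" arbitrary: I J a b rule: less_induct)
  case less
  note IH = less.hyps
  have fin: "finite I" "finite J" using less.prems by auto
  \<comment> \<open>Stated for arbitrary weights on the same vertex sets: it is applied below to the
    reduced weights \<open>a'\<close> and \<open>b'\<close>, for which the vertex count has not
    dropped and \<open>IH\<close> is not yet available.\<close>
  have reducible: "\<exists>x. ?sol I J a b x"
    if a0: "\<And>i. i \<in> I \<Longrightarrow> 0 \<le> a i" and b0: "\<And>j. j \<in> J \<Longrightarrow> 0 \<le> b j"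
      and hall: "\<And>K. K \<subseteq> J \<Longrightarrow> sum b K \<le> sum a {i\<in>I. \<exists>j\<in>K. R i j}"
      and red: "(\<exists>j\<in>J. b j = 0) \<or> (\<exists>i\<in>I. a i = 0) \<or>
        (\<exists>K\<subseteq>J. K \<noteq> {} \<and> K \<noteq> J \<and> sum b K = sum a {i\<in>I. \<exists>j\<in>K. R i j})"
    for a :: "'i \<Rightarrow> real" and b :: "'j \<Rightarrow> real"
    using red
  proof (elim disjE bexE exE conjE)
    fix j assume j: "j \<in> J" "b j = 0"
    have "card I + card (J - {j}) < card I + card J"
      using fin j by (simp add: card_Diff1_less del: card_Diff_insert)
    then have "\<exists>x. ?sol I (J - {j}) a b x"
      using a0 b0 hall fin by (intro IH) auto
    then obtain x where x: "?sol I (J - {j}) a b x" by blast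
    have z: "x i j = 0" for i using x by blast
    have "(\<Sum>k\<in>J. x i k) = (\<Sum>k\<in>J - {j}. x i k)" for i
      using z fin j by (simp add: sum.remove)
    then have "?sol I J a b x"
      using x z j by auto
    then show ?thesis by blast
  next
    fix i assume i: "i \<in> I" "a i = 0"
    have lt: "card (I - {i}) + card J < card I + card J"
      using fin i by (simp add: card_Diff1_less del: card_Diff_insert)
    have "sum b K \<le> sum a {k\<in>I - {i}. \<exists>j\<in>K. R k j}" if "K \<subseteq> J" for K
    proof -
      have "sum a {k\<in>I - {i}. \<exists>j\<in>K. R k j} = sum a {k\<in>I. \<exists>j\<in>K. R k j}"
        using fin i by (intro sum.mono_neutral_left) auto
      then show ?thesis using hall that by simp
    qed
    with lt have "\<exists>x. ?sol (I - {i}) J a b x"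
      using a0 b0 fin by (intro IH) auto
    then obtain x where x: "?sol (I - {i}) J a b x" by blast
    have z: "x i j = 0" for j using x by blast
    have "(\<Sum>k\<in>I. x k j) = (\<Sum>k\<in>I - {i}. x k j)" for j
      using z fin i by (simp add: sum.remove)
    then have "?sol I J a b x"
      using x z i by (metis (no_types, lifting) DiffE DiffI order_refl singletonD sum.neutral)
    then show ?thesis by blast
  next
    fix K assume K: "K \<subseteq> J" "K \<noteq> {}" "K \<noteq> J"
      and tight: "sum b K = sum a {i\<in>I. \<exists>j\<in>K. R i j}"
    \<comment> \<open>A tight \<open>K\<close> consumes the whole weight of its neighbours
      \<open>N\<close>, so nothing in \<open>N\<close> can serve \<open>J - K\<close>; the problem
      splits into \<open>N\<close>, \<open>K\<close> and \<open>I - N\<close>,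
      \<open>J - K\<close>.\<close>
    define N where "N = {i\<in>I. \<exists>j\<in>K. R i j}"
    have N: "N \<subseteq> I" "finite N" using fin by (auto simp: N_def)
    have finK: "finite K" using K fin finite_subset by blast
    have cK: "card K < card J" using K fin by (simp add: psubset_card_mono psubsetI)
    have cN: "card N \<le> card I" using N fin by (simp add: card_mono)
    have "sum b L \<le> sum a {i\<in>N. \<exists>j\<in>L. R i j}" if "L \<subseteq> K" for L
    proof -
      have "{i\<in>N. \<exists>j\<in>L. R i j} = {i\<in>I. \<exists>j\<in>L. R i j}" using that by (auto simp: N_def)
      then show ?thesis using hall[of L] that K by auto
    qed
    then have "\<exists>x. ?sol N K a b x"
      using a0 b0 N K cK cN finK by (intro IH) auto
    then obtain x where x: "?sol N K a b x" by blast
    \<comment> \<open>Hall's condition for \<open>L \<union> K\<close>, with the equality for the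
      tight set \<open>K\<close> subtracted.\<close>
    have hall2: "sum b L \<le> sum a {i\<in>I - N. \<exists>j\<in>L. R i j}" if L: "L \<subseteq> J - K" for L
    proof -
      have finL: "finite L" using L fin finite_subset by blast
      have "sum b L + sum b K = sum b (L \<union> K)"
        using L finL finK by (subst sum.union_disjoint) auto
      also have "\<dots> \<le> sum a {i\<in>I. \<exists>j\<in>L \<union> K. R i j}"
        using L K by (intro hall) auto
      also have "{i\<in>I. \<exists>j\<in>L \<union> K. R i j} = {i\<in>I - N. \<exists>j\<in>L. R i j} \<union> N"
        by (auto simp: N_def)
      also have "sum a \<dots> = sum a {i\<in>I - N. \<exists>j\<in>L. R i j} + sum a N"
        using fin N by (intro sum.union_disjoint) auto
      finally show ?thesis using tight by (simp add: N_def)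
    qed
    have "card (J - K) < card J"
      using K fin by (intro psubset_card_mono) auto
    moreover have "card (I - N) \<le> card I" using fin by (simp add: card_mono)
    ultimately have "\<exists>x. ?sol (I - N) (J - K) a b x"
      using a0 b0 hall2 fin by (intro IH) auto
    then obtain y where y: "?sol (I - N) (J - K) a b y" by blast
    have x0: "x i j = 0" if "i \<notin> N \<or> j \<notin> K" for i j using x that by blast
    have y0: "y i j = 0" if "i \<in> N \<or> j \<in> K" for i j using y that by blast
    \<comment> \<open>The support clause in \<open>?sol\<close> makes \<open>x\<close> and
      \<open>y\<close> vanish outside their blocks, so the plain sum is the block-diagonal
      combination.\<close>
    let ?z = "\<lambda>i j. x i j + y i j"
    have row: "(\<Sum>j\<in>J. ?z i j) = (\<Sum>j\<in>K. x i j) + (\<Sum>j\<in>J-K. y i j)" for i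
    proof -
      have "(\<Sum>j\<in>J. x i j) = (\<Sum>j\<in>K. x i j)"
        using fin K x0 by (intro sum.mono_neutral_right) auto
      moreover have "(\<Sum>j\<in>J. y i j) = (\<Sum>j\<in>J-K. y i j)"
        using fin K y0 by (intro sum.mono_neutral_right) auto
      ultimately show ?thesis by (simp add: sum.distrib)
    qed
    have col: "(\<Sum>i\<in>I. ?z i j) = (\<Sum>i\<in>N. x i j) + (\<Sum>i\<in>I-N. y i j)" for j
    proof -
      have "(\<Sum>i\<in>I. x i j) = (\<Sum>i\<in>N. x i j)"
        using fin N x0 by (intro sum.mono_neutral_right) auto
      moreover have "(\<Sum>i\<in>I. y i j) = (\<Sum>i\<in>I-N. y i j)"
        using fin N y0 by (intro sum.mono_neutral_right) auto
      ultimately show ?thesis by (simp add: sum.distrib)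
    qed
    have "?sol I J a b ?z"
    proof (intro conjI allI ballI impI)
      fix i j show "0 \<le> ?z i j" using x y by (simp add: add_nonneg_nonneg)
    next
      fix i j assume "?z i j \<noteq> 0"
      then have "x i j \<noteq> 0 \<or> y i j \<noteq> 0" by auto
      then show "i \<in> I" "j \<in> J" "R i j" using x y N K by blast+
    next
      fix i assume i: "i \<in> I"
      show "(\<Sum>j\<in>J. ?z i j) \<le> a i"
      proof (cases "i \<in> N")
        case True
        then have "(\<Sum>j\<in>K. x i j) \<le> a i" "(\<Sum>j\<in>J-K. y i j) = 0" using x y0 by auto
        then show ?thesis unfolding row by simp
      next
        case False
        then have "(\<Sum>j\<in>K. x i j) = 0" "(\<Sum>j\<in>J-K. y i j) \<le> a i" using y i x0 by auto
        then show ?thesis unfolding row by simp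
      qed
    next
      fix j assume j: "j \<in> J"
      show "(\<Sum>i\<in>I. ?z i j) = b j"
      proof (cases "j \<in> K")
        case True
        then have "(\<Sum>i\<in>N. x i j) = b j" "(\<Sum>i\<in>I-N. y i j) = 0" using x y0 by auto
        then show ?thesis unfolding col by simp
      next
        case False
        then have "(\<Sum>i\<in>N. x i j) = 0" "(\<Sum>i\<in>I-N. y i j) = b j" using y j x0 by auto
        then show ?thesis unfolding col by simp
      qed
    qed
    then show ?thesis by (rule exI[of _ ?z])
  qed
  show ?case
  proof (cases "J = {}")
    case True
    then show ?thesis using less.prems by (intro exI[of _ "\<lambda>i j. 0"]) auto
  next
    case False
    then obtain j where j: "j \<in> J" by blast
    note a0 = less.prems(3) and b0 = less.prems(4) and hall = less.prems(5)
    show ?thesis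
    proof (cases "\<exists>i\<in>I. R i j")
      case False
      then have *: "{i\<in>I. \<exists>k\<in>{j}. R i k} = {}" by auto
      have "b j \<le> 0" using hall[of "{j}"] j unfolding * by simp
      then have "b j = 0" using b0[OF j] by simp
      then show ?thesis using j by (intro reducible a0 b0 hall) auto
    next
      case True
      then obtain i where i: "i \<in> I" "R i j" by blast
      \<comment> \<open>Send as much mass \<open>t\<close> through the edge \<open>(i, j)\<close> as Hall's condition permits; then a
        vertex is exhausted or a set \<open>K\<close> becomes tight, and the problem splits.\<close>
      define N where "N K = {i\<in>I. \<exists>j\<in>K. R i j}" for K
      \<comment> \<open>Only these sets lose slack when \<open>t\<close> is taken from
        \<open>a i\<close> and \<open>b j\<close>: if \<open>j\<close> is in \<open>K\<close>, the
        edge puts \<open>i\<close> into \<open>N K\<close> and both sides drop by \<open>t\<close>;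
        if \<open>i\<close> is not in \<open>N K\<close>, the right side does not change.\<close>
      define \<K> where "\<K> = {K. K \<subseteq> J - {j} \<and> i \<in> N K}"
      define T where "T = insert (a i) (insert (b j) ((\<lambda>K. sum a (N K) - sum b K) ` \<K>))"
      define t where "t = Min T"
      have "finite \<K>" using fin by (auto simp: \<K>_def intro: finite_subset[of _ "Pow J"])
      then have finT: "finite T" "T \<noteq> {}" by (auto simp: T_def)
      have t_le: "t \<le> s" if "s \<in> T" for s using finT that by (simp add: t_def)
      have t_in: "t \<in> T" using finT by (simp add: t_def)
      have t0: "0 \<le> t"
      proof -
        have "0 \<le> sum a (N K) - sum b K" if "K \<in> \<K>" for K
          using hall[of K] that by (auto simp: \<K>_def N_def)
        then show ?thesis using t_in a0 b0 i j by (auto simp: T_def)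
      qed
      define a' where "a' = a(i := a i - t)"
      define b' where "b' = b(j := b j - t)"
      have finN: "finite (N K)" for K using fin by (auto simp: N_def)
      have sa: "sum a' L = sum a L - (if i \<in> L then t else 0)" if "finite L" for L
      proof (cases "i \<in> L")
        case True
        have "sum a' (L - {i}) = sum a (L - {i})" by (rule sum.cong) (auto simp: a'_def)
        then show ?thesis using True that by (simp add: sum.remove[of L i] a'_def)
      next
        case False
        then show ?thesis by (auto simp: a'_def intro!: sum.cong)
      qed
      have sb: "sum b' L = sum b L - (if j \<in> L then t else 0)" if "finite L" for L
      proof (cases "j \<in> L")
        case True
        have "sum b' (L - {j}) = sum b (L - {j})" by (rule sum.cong) (auto simp: b'_def)
        then show ?thesis using True that by (simp add: sum.remove[of L j] b'_def)
      next
        case False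
        then show ?thesis by (auto simp: b'_def intro!: sum.cong)
      qed
      have hall': "sum b' K \<le> sum a' {i\<in>I. \<exists>j\<in>K. R i j}" if K: "K \<subseteq> J" for K
      proof -
        have finK: "finite K" using K fin finite_subset by blast
        have h: "sum b K \<le> sum a (N K)" using hall[OF K] by (simp add: N_def)
        have "j \<in> K \<Longrightarrow> i \<in> N K" using i by (auto simp: N_def)
        moreover have "t \<le> sum a (N K) - sum b K" if "j \<notin> K" "i \<in> N K"
          using that K by (intro t_le) (auto simp: T_def \<K>_def)
        ultimately have "sum b' K \<le> sum a' (N K)"
          using h by (auto simp: sa sb finN finK)
        then show ?thesis by (simp add: N_def)
      qed
      have "\<exists>x. ?sol I J a' b' x"
      proof (rule reducible)
        show "0 \<le> a' k" if "k \<in> I" for k using that a0 t_le by (auto simp: a'_def T_def)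
        show "0 \<le> b' k" if "k \<in> J" for k using that b0 t_le by (auto simp: b'_def T_def)
        consider "t = a i" | "t = b j" | K where "K \<in> \<K>" "t = sum a (N K) - sum b K"
          using t_in by (auto simp: T_def)
        then show "(\<exists>j\<in>J. b' j = 0) \<or> (\<exists>i\<in>I. a' i = 0) \<or>
          (\<exists>K\<subseteq>J. K \<noteq> {} \<and> K \<noteq> J \<and> sum b' K = sum a' {i\<in>I. \<exists>j\<in>K. R i j})"
        proof cases
          case 1 then show ?thesis using i by (auto simp: a'_def)
        next
          case 2 then show ?thesis using j by (auto simp: b'_def)
        next
          case 3
          then have K: "K \<subseteq> J - {j}" "i \<in> N K" by (auto simp: \<K>_def)
          then have finK: "finite K" using fin finite_subset by blast
          have "sum b' K = sum a' (N K)"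
            using K 3 by (auto simp: sa sb finN finK)
          moreover have "K \<noteq> {}" using K by (auto simp: N_def)
          ultimately have "K \<subseteq> J \<and> K \<noteq> {} \<and> K \<noteq> J \<and> sum b' K = sum a' {i\<in>I. \<exists>j\<in>K. R i j}"
            using K(1) j unfolding N_def by blast
          then show ?thesis by blast
        qed
      qed (fact hall')
      then obtain x where x: "?sol I J a' b' x" by blast
      let ?z = "\<lambda>k l. x k l + (if k = i \<and> l = j then t else 0)"
      have row: "(\<Sum>l\<in>J. ?z k l) = (\<Sum>l\<in>J. x k l) + (if k = i then t else 0)" for k
        using fin j by (simp add: sum.distrib)
      have col: "(\<Sum>k\<in>I. ?z k l) = (\<Sum>k\<in>I. x k l) + (if l = j then t else 0)" for l
        using fin i by (simp add: sum.distrib)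
      have "?sol I J a b ?z"
      proof (intro conjI allI ballI impI)
        fix k l show "0 \<le> ?z k l" using x t0 by (simp add: add_nonneg_nonneg)
      next
        fix k l assume "?z k l \<noteq> 0"
        then have "x k l \<noteq> 0 \<or> (k = i \<and> l = j)" by (auto split: if_splits)
        then show "k \<in> I" "l \<in> J" "R k l" using x i j by blast+
      next
        fix k assume "k \<in> I"
        then have "(\<Sum>l\<in>J. x k l) \<le> a' k" using x by blast
        then show "(\<Sum>l\<in>J. ?z k l) \<le> a k"
          unfolding row by (auto simp: a'_def split: if_splits)
      next
        fix l assume "l \<in> J"
        then have "(\<Sum>k\<in>I. x k l) = b' l" using x by blast
        then show "(\<Sum>k\<in>I. ?z k l) = b l"
          unfolding col by (auto simp: b'_def split: if_splits)
      qed
      then show ?thesis by (rule exI[of _ ?z])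
    qed
  qed
qed

text \<open>An additional left vertex \<open>None\<close> of weight \<open>c\<close>, joined to all
  of \<open>J\<close>, absorbs the deficit. Deleting its row afterwards turns the equalities on
  \<open>J\<close> into inequalities and loses at most \<open>c\<close> in total.\<close>

lemma weighted_hall_deficit:
  fixes a :: "'i \<Rightarrow> real" and b :: "'j \<Rightarrow> real" and R :: "'i \<Rightarrow> 'j \<Rightarrow> bool"
  assumes fin: "finite I" "finite J" and c: "0 \<le> c"
    and a0: "\<And>i. i \<in> I \<Longrightarrow> 0 \<le> a i" and b0: "\<And>j. j \<in> J \<Longrightarrow> 0 \<le> b j"
    and hall: "\<And>K. K \<subseteq> J \<Longrightarrow> sum b K \<le> sum a {i\<in>I. \<exists>j\<in>K. R i j} + c"
  obtains x where "\<And>i j. 0 \<le> x i j" "\<And>i j. x i j \<noteq> 0 \<Longrightarrow> i \<in> I \<and> j \<in> J \<and> R i j"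
    "\<And>i. i \<in> I \<Longrightarrow> (\<Sum>j\<in>J. x i j) \<le> a i" "\<And>j. j \<in> J \<Longrightarrow> (\<Sum>i\<in>I. x i j) \<le> b j"
    "sum b J - c \<le> (\<Sum>i\<in>I. \<Sum>j\<in>J. x i j)"
proof -
  let ?I = "insert None (Some ` I)"
  let ?a = "case_option c a"
  let ?R = "\<lambda>i j. case i of None \<Rightarrow> True | Some i \<Rightarrow> R i j"
  have "\<exists>x. (\<forall>i j. 0 \<le> x i j) \<and> (\<forall>i j. x i j \<noteq> 0 \<longrightarrow> i \<in> ?I \<and> j \<in> J \<and> ?R i j)
           \<and> (\<forall>i\<in>?I. (\<Sum>j\<in>J. x i j) \<le> ?a i) \<and> (\<forall>j\<in>J. (\<Sum>i\<in>?I. x i j) = b j)"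
  proof (rule weighted_hall)
    fix K assume K: "K \<subseteq> J"
    show "sum b K \<le> sum ?a {i\<in>?I. \<exists>j\<in>K. ?R i j}"
    proof (cases "K = {}")
      case False
      then have "{i\<in>?I. \<exists>j\<in>K. ?R i j} = insert None (Some ` {i\<in>I. \<exists>j\<in>K. R i j})"
        by (auto simp: image_iff)
      then show ?thesis using hall[OF K] fin by (simp add: sum.reindex)
    qed simp
  qed (use fin c a0 b0 in auto)
  then obtain x where x: "\<And>i j. 0 \<le> x i j"
    "\<And>i j. x i j \<noteq> 0 \<Longrightarrow> i \<in> ?I \<and> j \<in> J \<and> ?R i j"
    "\<And>i. i \<in> ?I \<Longrightarrow> (\<Sum>j\<in>J. x i j) \<le> ?a i"
    "\<And>j. j \<in> J \<Longrightarrow> (\<Sum>i\<in>?I. x i j) = b j" by blast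
  have col: "x None j + (\<Sum>i\<in>I. x (Some i) j) = b j" if "j \<in> J" for j
    using x(4)[OF that] fin by (simp add: sum.reindex)
  show thesis
  proof (rule that[of "\<lambda>i j. x (Some i) j"])
    show "(\<Sum>j\<in>J. x (Some i) j) \<le> a i" if "i \<in> I" for i
      using x(3)[of "Some i"] that by simp
    show "(\<Sum>i\<in>I. x (Some i) j) \<le> b j" if "j \<in> J" for j
      using col[OF that] x(1)[of None j] by linarith
    have "sum b J = (\<Sum>j\<in>J. x None j) + (\<Sum>j\<in>J. \<Sum>i\<in>I. x (Some i) j)"
      by (simp add: col sum.distrib[symmetric])
    moreover have "(\<Sum>j\<in>J. x None j) \<le> c" using x(3)[of None] by simp
    ultimately show "sum b J - c \<le> (\<Sum>i\<in>I. \<Sum>j\<in>J. x (Some i) j)"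
      by (subst sum.swap) linarith
  qed (use x(1) x(2)[of "Some _"] in auto)
qed

section \<open>Finitely additive partial couplings\<close>

text \<open>Required on the full power set: finite sums of point masses are defined there, and their
  pointwise limits inherit additivity without any measurability condition.\<close>

definition fin_additive :: "('b set \<Rightarrow> real) \<Rightarrow> bool" where
  "fin_additive f \<longleftrightarrow> (\<forall>R. 0 \<le> f R) \<and> (\<forall>R T. R \<inter> T = {} \<longrightarrow> f (R \<union> T) = f R + f T)"

lemma fin_additive_nonneg: "fin_additive f \<Longrightarrow> 0 \<le> f R"
  by (simp add: fin_additive_def)

lemma fin_additive_Un: "fin_additive f \<Longrightarrow> R \<inter> T = {} \<Longrightarrow> f (R \<union> T) = f R + f T"
  by (simp add: fin_additive_def)

lemma fin_additive_empty: "fin_additive f \<Longrightarrow> f {} = 0"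
  using fin_additive_Un[of f "{}" "{}"] by simp

lemma fin_additive_mono:
  assumes "fin_additive f" "R \<subseteq> T" shows "f R \<le> f T"
proof -
  have "f T = f R + f (T - R)"
    using fin_additive_Un[OF assms(1), of R "T - R"] assms(2) by (simp add: Un_absorb1)
  then show ?thesis using fin_additive_nonneg[OF assms(1), of "T - R"] by simp
qed

lemma fin_additive_subadditive:
  assumes "fin_additive f" shows "f (R \<union> T) \<le> f R + f T"
proof -
  have "f (R \<union> T) = f R + f (T - R)"
    using fin_additive_Un[OF assms, of R "T - R"] by simp
  then show ?thesis using fin_additive_mono[OF assms, of "T - R" T] by simp
qed

lemma fin_additive_UN_le:
  assumes "fin_additive f" "finite I" shows "f (\<Union>i\<in>I. T i) \<le> (\<Sum>i\<in>I. f (T i))"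
  using assms(2)
proof induction
  case empty
  then show ?case by (simp add: fin_additive_empty[OF assms(1)])
next
  case (insert i I)
  then show ?case using fin_additive_subadditive[OF assms(1), of "T i" "\<Union>i\<in>I. T i"] by simp
qed

lemma fin_additive_weighted_points:
  assumes "\<And>i. i \<in> I \<Longrightarrow> 0 \<le> w i"
  shows "fin_additive (\<lambda>R. \<Sum>i\<in>I. w i * indicator R (p i))"
  unfolding fin_additive_def
  using assms by (auto intro!: sum_nonneg sum.cong simp: sum.distrib[symmetric] indicator_def)

text \<open>The vertices are the atoms of the algebra generated by \<open>F\<close>, encoded by the
  family \<open>a z\<close> of members of \<open>F\<close> that contain \<open>z\<close>; two atoms
  are joined if some pair of their points lies in \<open>S\<close>. The mass of an edge sits at the
  pair of chosen representatives \<open>z s\<close>, \<open>z t\<close>, which need not lie in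
  \<open>S\<close> itself. Hence vanishing is claimed only for rectangles with sides in
  \<open>F\<close>: these are unions of products of atoms, and a product that carries mass meets
  \<open>S\<close>.\<close>

lemma discrete_partial_coupling:
  fixes \<mu> \<nu> :: "'a::topological_space measure" and S :: "('a \<times> 'a) set"
  assumes \<mu>: "finite_borel_measure \<mu>" and \<nu>: "finite_borel_measure \<nu>" and c: "0 \<le> c"
    and hall: "\<And>B U. B \<in> sets borel \<Longrightarrow> U \<in> sets borel \<Longrightarrow> {x. \<exists>y\<in>B. (x, y) \<in> S} \<subseteq> U
                  \<Longrightarrow> measure \<nu> B \<le> measure \<mu> U + c"
    and F: "finite F" "F \<subseteq> sets borel"
  obtains \<beta> where "fin_additive \<beta>" "\<beta> UNIV \<le> measure \<nu> UNIV" "measure \<nu> UNIV - c \<le> \<beta> UNIV"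
    "\<And>A. A \<in> F \<Longrightarrow> \<beta> (A \<times> UNIV) \<le> measure \<mu> A"
    "\<And>B. B \<in> F \<Longrightarrow> \<beta> (UNIV \<times> B) \<le> measure \<nu> B"
    "\<And>A B. A \<in> F \<Longrightarrow> B \<in> F \<Longrightarrow> (A \<times> B) \<inter> S = {} \<Longrightarrow> \<beta> (A \<times> B) = 0"
proof -
  interpret \<mu>: finite_measure \<mu> using \<mu> by (simp add: finite_borel_measure_def)
  interpret \<nu>: finite_measure \<nu> using \<nu> by (simp add: finite_borel_measure_def)
  have [simp]: "sets \<mu> = sets borel" "sets \<nu> = sets borel"
    using \<mu> \<nu> by (auto simp: finite_borel_measure_def)
  define a where "a z = {A\<in>F. z \<in> A}" for z
  define I where "I = range a"
  have I: "finite I" using F by (auto simp: I_def a_def intro: finite_subset[of _ "Pow F"])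
  have atom: "a -` {s} \<in> sets borel" for s
  proof (cases "s \<subseteq> F")
    case True
    have "z \<in> a -` {s} \<longleftrightarrow> (\<forall>A\<in>F. z \<in> A \<longleftrightarrow> A \<in> s)" for z
      using True unfolding a_def by blast
    then have "a -` {s} = {z\<in>space borel. \<forall>A\<in>F. z \<in> A \<longleftrightarrow> A \<in> s}" by auto
    also have "\<dots> \<in> sets borel"
    proof (rule sets.sets_Collect_finite_All[OF _ F(1)])
      fix A assume "A \<in> F"
      then have "A \<in> sets borel" using F by blast
      moreover have "{z\<in>space borel. z \<in> A \<longleftrightarrow> A \<in> s} = (if A \<in> s then A else UNIV - A)" by auto
      ultimately show "{z\<in>space borel. z \<in> A \<longleftrightarrow> A \<in> s} \<in> sets borel" by simp
    qed
    finally show ?thesis .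
  next
    case False
    then have "a -` {s} = {}" unfolding a_def by blast
    then show ?thesis by simp
  qed
  have vim: "a -` J = (\<Union>s\<in>J. a -` {s})" for J by auto
  have finJ: "finite J" if "J \<subseteq> I" for J using that I finite_subset by blast
  have vimB: "a -` J \<in> sets borel" if "J \<subseteq> I" for J
    unfolding vim[of J] using atom finJ[OF that] by (intro sets.finite_UN) auto
  have mu_sum: "measure \<mu> (a -` J) = (\<Sum>s\<in>J. measure \<mu> (a -` {s}))" if "J \<subseteq> I" for J
    unfolding vim[of J] using atom finJ[OF that]
    by (intro \<mu>.finite_measure_finite_Union) (auto simp: disjoint_family_on_def)
  have nu_sum: "measure \<nu> (a -` J) = (\<Sum>s\<in>J. measure \<nu> (a -` {s}))" if "J \<subseteq> I" for J
    unfolding vim[of J] using atom finJ[OF that]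
    by (intro \<nu>.finite_measure_finite_Union) (auto simp: disjoint_family_on_def)
  define R where "R s t \<longleftrightarrow> (\<exists>x y. a x = s \<and> a y = t \<and> (x, y) \<in> S)" for s t
  obtain x where x: "\<And>i j. 0 \<le> x i j" "\<And>i j. x i j \<noteq> 0 \<Longrightarrow> i \<in> I \<and> j \<in> I \<and> R i j"
    "\<And>i. i \<in> I \<Longrightarrow> (\<Sum>j\<in>I. x i j) \<le> measure \<mu> (a -` {i})"
    "\<And>j. j \<in> I \<Longrightarrow> (\<Sum>i\<in>I. x i j) \<le> measure \<nu> (a -` {j})"
    "(\<Sum>j\<in>I. measure \<nu> (a -` {j})) - c \<le> (\<Sum>i\<in>I. \<Sum>j\<in>I. x i j)"
  proof (rule weighted_hall_deficit[OF I I c, of "\<lambda>s. measure \<mu> (a -` {s})" "\<lambda>s. measure \<nu> (a -` {s})" R])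
    fix K assume K: "K \<subseteq> I"
    let ?N = "{i \<in> I. \<exists>j\<in>K. R i j}"
    \<comment> \<open>The atoms in \<open>?N\<close> form a Borel set containing all
      \<open>S\<close>-partners of the atoms in \<open>K\<close>. The partners themselves may fail
      to form a Borel set, which is why \<open>hall\<close> speaks of Borel supersets
      \<open>U\<close>.\<close>
    have "measure \<nu> (a -` K) \<le> measure \<mu> (a -` ?N) + c"
      using K by (intro hall vimB) (auto simp: R_def I_def)
    then show "(\<Sum>s\<in>K. measure \<nu> (a -` {s})) \<le> (\<Sum>s\<in>?N. measure \<mu> (a -` {s})) + c"
      using nu_sum[OF K] mu_sum[of ?N] by simp
  qed auto
  define z where "z s = (SOME z. a z = s)" for s
  have z: "a (z s) = s" if "s \<in> I" for s
    using that unfolding z_def I_def by (metis (mono_tags) rangeE someI)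
  have z_in: "z s \<in> A \<longleftrightarrow> A \<in> s" if "s \<in> I" "A \<in> F" for s A
    using z[OF that(1)] that(2) by (auto simp: a_def)
  have F_eq: "a -` {s \<in> I. z s \<in> A} = A" if "A \<in> F" for A
    using that z_in by (auto simp: I_def a_def)
  define \<beta> where "\<beta> T = (\<Sum>(s,t)\<in>I \<times> I. x s t * indicator T (z s, z t))" for T
  have \<beta>_alt: "\<beta> T = (\<Sum>s\<in>I. \<Sum>t\<in>I. x s t * indicator T (z s, z t))" for T
    by (simp add: \<beta>_def sum.cartesian_product)
  have UNIV_eq: "a -` I = UNIV" by (auto simp: I_def)
  show thesis
  proof (rule that[of \<beta>])
    show "fin_additive \<beta>"
      using fin_additive_weighted_points[of "I \<times> I" "\<lambda>(s,t). x s t" "\<lambda>(s,t). (z s, z t)"] x(1)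
      by (simp add: \<beta>_def[abs_def] case_prod_unfold)
    have tot: "\<beta> UNIV = (\<Sum>s\<in>I. \<Sum>t\<in>I. x s t)" by (simp add: \<beta>_alt)
    also have "\<dots> = (\<Sum>t\<in>I. \<Sum>s\<in>I. x s t)" by (rule sum.swap)
    also have "\<dots> \<le> (\<Sum>t\<in>I. measure \<nu> (a -` {t}))" by (intro sum_mono x(4))
    also have "\<dots> = measure \<nu> UNIV" using nu_sum[of I] by (simp add: UNIV_eq)
    finally show "\<beta> UNIV \<le> measure \<nu> UNIV" .
    show "measure \<nu> UNIV - c \<le> \<beta> UNIV"
      using x(5) nu_sum[of I] unfolding tot by (simp add: UNIV_eq)
  next
    fix A assume A: "A \<in> F"
    have "\<beta> (A \<times> UNIV) = (\<Sum>s\<in>I. if z s \<in> A then \<Sum>t\<in>I. x s t else 0)"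
      unfolding \<beta>_alt by (intro sum.cong) (auto simp: indicator_def)
    also have "\<dots> = (\<Sum>s\<in>{s\<in>I. z s \<in> A}. \<Sum>t\<in>I. x s t)"
      using I by (simp add: sum.inter_filter)
    also have "\<dots> \<le> (\<Sum>s\<in>{s\<in>I. z s \<in> A}. measure \<mu> (a -` {s}))"
      by (intro sum_mono x(3)) auto
    also have "\<dots> = measure \<mu> A"
      using mu_sum[of "{s\<in>I. z s \<in> A}"] F_eq[OF A] by auto
    finally show "\<beta> (A \<times> UNIV) \<le> measure \<mu> A" .
  next
    fix A assume A: "A \<in> F"
    have "\<beta> (UNIV \<times> A) = (\<Sum>t\<in>I. \<Sum>s\<in>I. x s t * indicator (UNIV \<times> A) (z s, z t))"
      unfolding \<beta>_alt by (rule sum.swap)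
    also have "\<dots> = (\<Sum>t\<in>I. if z t \<in> A then \<Sum>s\<in>I. x s t else 0)"
      by (intro sum.cong) (auto simp: indicator_def)
    also have "\<dots> = (\<Sum>t\<in>{s\<in>I. z s \<in> A}. \<Sum>s\<in>I. x s t)"
      using I by (simp add: sum.inter_filter)
    also have "\<dots> \<le> (\<Sum>s\<in>{s\<in>I. z s \<in> A}. measure \<nu> (a -` {s}))"
      by (intro sum_mono x(4)) auto
    also have "\<dots> = measure \<nu> A"
      using nu_sum[of "{s\<in>I. z s \<in> A}"] F_eq[OF A] by auto
    finally show "\<beta> (UNIV \<times> A) \<le> measure \<nu> A" .
  next
    fix A B assume AB: "A \<in> F" "B \<in> F" "(A \<times> B) \<inter> S = {}"
    have "x s t * indicator (A \<times> B) (z s, z t) = 0" if st: "s \<in> I" "t \<in> I" for s t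
    proof (rule ccontr)
      assume "x s t * indicator (A \<times> B) (z s, z t) \<noteq> 0"
      then have "x s t \<noteq> 0" "z s \<in> A" "z t \<in> B" by (auto simp: indicator_def split: if_splits)
      then obtain u v where "a u = s" "a v = t" "(u, v) \<in> S" "A \<in> s" "B \<in> t"
        using x(2)[of s t] z_in st AB by (auto simp: R_def)
      then show False using AB by (auto simp: a_def)
    qed
    then show "\<beta> (A \<times> B) = 0" unfolding \<beta>_alt by (intro sum.neutral ballI)
  qed
qed

text \<open>Each requirement involves finitely many coordinates \<beta>(R), so it cuts out a closed
  subset of a product of compact intervals; the finite intersection property leaves a point that
  meets all requirements at once.\<close>

lemma fin_additive_partial_coupling:
  fixes \<mu> \<nu> :: "'a::topological_space measure" and S :: "('a \<times> 'a) set"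
  assumes \<mu>: "finite_borel_measure \<mu>" and \<nu>: "finite_borel_measure \<nu>" and c: "0 \<le> c"
    and hall: "\<And>B U. B \<in> sets borel \<Longrightarrow> U \<in> sets borel \<Longrightarrow> {x. \<exists>y\<in>B. (x, y) \<in> S} \<subseteq> U
                  \<Longrightarrow> measure \<nu> B \<le> measure \<mu> U + c"
  obtains \<beta> where "fin_additive \<beta>" "measure \<nu> UNIV - c \<le> \<beta> UNIV"
    "\<And>A. A \<in> sets borel \<Longrightarrow> \<beta> (A \<times> UNIV) \<le> measure \<mu> A"
    "\<And>B. B \<in> sets borel \<Longrightarrow> \<beta> (UNIV \<times> B) \<le> measure \<nu> B"
    "\<And>A B. A \<in> sets borel \<Longrightarrow> B \<in> sets borel \<Longrightarrow> (A \<times> B) \<inter> S = {} \<Longrightarrow> \<beta> (A \<times> B) = 0"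
proof -
  define X where "X = {\<beta> :: ('a \<times> 'a) set \<Rightarrow> real. \<forall>R. \<beta> R \<in> {0..measure \<nu> UNIV}}"
  have "X = PiE UNIV (\<lambda>_. {0..measure \<nu> UNIV})" by (auto simp: X_def)
  then have "compactin (product_topology (\<lambda>_. euclidean) UNIV) X"
    by (simp add: compactin_PiE)
  then have X: "compact X"
    by (simp add: euclidean_product_topology)
  define C where "C F = {\<beta> :: ('a \<times> 'a) set \<Rightarrow> real. fin_additive \<beta> \<and> measure \<nu> UNIV - c \<le> \<beta> UNIV
      \<and> (\<forall>A\<in>F. \<beta> (A \<times> UNIV) \<le> measure \<mu> A) \<and> (\<forall>B\<in>F. \<beta> (UNIV \<times> B) \<le> measure \<nu> B)
      \<and> (\<forall>A\<in>F. \<forall>B\<in>F. (A \<times> B) \<inter> S = {} \<longrightarrow> \<beta> (A \<times> B) = 0)}" for F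
  have cont: "continuous_on UNIV (\<lambda>\<beta> :: ('a \<times> 'a) set \<Rightarrow> real. \<beta> R)" for R
    by (rule continuous_on_product_coordinates)
  have closed: "closed (C F)" for F
  proof -
    have le: "closed {\<beta> :: ('a \<times> 'a) set \<Rightarrow> real. r \<le> \<beta> R}" "closed {\<beta> :: ('a \<times> 'a) set \<Rightarrow> real. \<beta> R \<le> r}" for r R
      by (intro closed_Collect_le continuous_on_const cont)+
    have zero: "closed {\<beta> :: ('a \<times> 'a) set \<Rightarrow> real. P \<longrightarrow> \<beta> R = 0}" for P R
      by (cases P) (auto intro!: closed_Collect_eq cont)
    have add: "closed {\<beta> :: ('a \<times> 'a) set \<Rightarrow> real. R \<inter> T = {} \<longrightarrow> \<beta> (R \<union> T) = \<beta> R + \<beta> T}" for R T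
      by (cases "R \<inter> T = {}") (auto intro!: closed_Collect_eq continuous_on_add cont)
    have ball: "closed {\<beta> :: ('a \<times> 'a) set \<Rightarrow> real. \<forall>A\<in>F. P A \<beta>}" if "\<And>A. closed {\<beta>. P A \<beta>}" for P
      unfolding Collect_ball_eq using that by blast
    show ?thesis
      unfolding C_def fin_additive_def
      by (intro closed_Collect_conj closed_Collect_all ball le zero add)
  qed
  have "X \<inter> (\<Inter>F\<in>{F. finite F \<and> F \<subseteq> sets borel}. C F) \<noteq> {}"
  proof (rule compact_imp_fip_image[OF X closed])
    fix \<F> assume \<F>: "finite \<F>" "\<F> \<subseteq> {F. finite F \<and> F \<subseteq> sets (borel :: 'a measure)}"
    \<comment> \<open>A single discrete coupling for the union of the finitely many families lies in
      every \<open>C F\<close> simultaneously.\<close>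
    obtain \<beta> where \<beta>: "fin_additive \<beta>" "\<beta> UNIV \<le> measure \<nu> UNIV" "measure \<nu> UNIV - c \<le> \<beta> UNIV"
      "\<And>A. A \<in> \<Union>\<F> \<Longrightarrow> \<beta> (A \<times> UNIV) \<le> measure \<mu> A"
      "\<And>B. B \<in> \<Union>\<F> \<Longrightarrow> \<beta> (UNIV \<times> B) \<le> measure \<nu> B"
      "\<And>A B. A \<in> \<Union>\<F> \<Longrightarrow> B \<in> \<Union>\<F> \<Longrightarrow> (A \<times> B) \<inter> S = {} \<Longrightarrow> \<beta> (A \<times> B) = 0"
      by (rule discrete_partial_coupling[OF \<mu> \<nu> c hall, where F = "\<Union>\<F>"]) (use \<F> in auto)
    have "\<beta> R \<le> measure \<nu> UNIV" for R
      using fin_additive_mono[OF \<beta>(1), of R UNIV] \<beta>(2) by simp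
    then have "\<beta> \<in> X" using fin_additive_nonneg[OF \<beta>(1)] by (simp add: X_def)
    moreover have "\<beta> \<in> C F" if "F \<in> \<F>" for F
      using \<beta> that unfolding C_def by blast
    ultimately show "X \<inter> (\<Inter>F\<in>\<F>. C F) \<noteq> {}" by blast
  qed
  then obtain \<beta> where \<beta>: "\<beta> \<in> C F" if "finite F" "F \<subseteq> sets borel" for F by blast
  show thesis
  proof (rule that[of \<beta>])
    show "fin_additive \<beta>" "measure \<nu> UNIV - c \<le> \<beta> UNIV" using \<beta>[of "{}"] by (auto simp: C_def)
    show "\<beta> (A \<times> UNIV) \<le> measure \<mu> A" "\<beta> (UNIV \<times> A) \<le> measure \<nu> A" if "A \<in> sets borel" for A
      using \<beta>[of "{A}"] that by (auto simp: C_def)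
    show "\<beta> (A \<times> B) = 0" if "A \<in> sets borel" "B \<in> sets borel" "(A \<times> B) \<inter> S = {}" for A B
      using \<beta>[of "{A, B}"] that by (auto simp: C_def)
  qed
qed

section \<open>Extension to a Borel measure\<close>

lemma finite_borel_measureD:
  assumes "finite_borel_measure M"
  shows "finite_measure M" "sets M = sets borel" "space M = UNIV"
  using assms sets_eq_imp_space_eq[of M borel] by (auto simp: finite_borel_measure_def)

lemma compact_inner_approx:
  fixes M :: "'a::polish_space measure"
  assumes M: "finite_borel_measure M" and A: "A \<in> sets borel" and e: "0 < e"
  obtains K where "compact K" "K \<subseteq> A" "measure M (A - K) \<le> e"
proof -
  note M' = finite_borel_measureD[OF M]
  interpret finite_measure M by fact
  have *: "emeasure M A = (SUP K \<in> {K. K \<subseteq> A \<and> compact K}. emeasure M K)"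
    using M' A emeasure_finite by (intro inner_regular) auto
  have "\<exists>K. K \<subseteq> A \<and> compact K \<and> emeasure M A \<le> emeasure M K + ennreal e"
  proof (rule ccontr)
    assume "\<not> ?thesis"
    then have le: "emeasure M K + ennreal e \<le> emeasure M A" if "K \<subseteq> A" "compact K" for K
      using that by (meson linear)
    have "(SUP K \<in> {K. K \<subseteq> A \<and> compact K}. emeasure M K + ennreal e) \<le> emeasure M A"
      by (intro SUP_least) (use le in auto)
    then have "emeasure M A + ennreal e \<le> emeasure M A"
      by (subst (asm) ennreal_SUP_add_left) (auto simp: *[symmetric] )
    then show False
      using e emeasure_finite[of A] by (simp add: emeasure_eq_measure flip: ennreal_plus)
  qed
  then obtain K where K: "K \<subseteq> A" "compact K" "emeasure M A \<le> emeasure M K + ennreal e" by blast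
  have "K \<in> sets M" using K M' by (simp add: borel_compact)
  then have "measure M (A - K) = measure M A - measure M K"
    using A K M' by (intro finite_measure_Diff) auto
  moreover have "measure M A \<le> measure M K + e"
    using K(3) e by (simp add: emeasure_eq_measure flip: ennreal_plus)
  ultimately show thesis using K by (intro that[of K]) auto
qed

lemma sum_half_powers_le_1: "(\<Sum>m\<le>n. (1/2) ^ Suc m :: real) \<le> 1"
proof -
  have "(\<Sum>m\<le>n. (1/2) ^ Suc m :: real) = 1 - (1/2) ^ Suc n" by (induction n) auto
  then show ?thesis by simp
qed

text \<open>The sets that can be approximated by compact sets both from inside and from inside their
  complement form an algebra on which \<open>\<beta>\<close> is continuous at the empty set.\<close>

lemma fin_additive_extends_to_measure:
  fixes \<mu> \<nu> :: "'a::polish_space measure"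
  assumes \<mu>: "finite_borel_measure \<mu>" and \<nu>: "finite_borel_measure \<nu>"
    and \<beta>: "fin_additive \<beta>"
    and \<beta>\<mu>: "\<And>A. A \<in> sets borel \<Longrightarrow> \<beta> (A \<times> UNIV) \<le> measure \<mu> A"
    and \<beta>\<nu>: "\<And>B. B \<in> sets borel \<Longrightarrow> \<beta> (UNIV \<times> B) \<le> measure \<nu> B"
  obtains \<gamma> where "finite_borel_measure \<gamma>"
    "\<And>A B. A \<in> sets borel \<Longrightarrow> B \<in> sets borel \<Longrightarrow> measure \<gamma> (A \<times> B) = \<beta> (A \<times> B)"
proof -
  define \<M> where "\<M> = {R. \<forall>e>0. \<exists>C D. compact C \<and> compact D \<and> C \<subseteq> R \<and> D \<subseteq> - R \<and> \<beta> (- (C \<union> D)) \<le> e}"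
  note nonneg = fin_additive_nonneg[OF \<beta>] and mono = fin_additive_mono[OF \<beta>]
    and subadd = fin_additive_subadditive[OF \<beta>]
  have \<M>I: "R \<in> \<M>" if "\<And>e. 0 < e \<Longrightarrow> \<exists>C D. compact C \<and> compact D \<and> C \<subseteq> R \<and> D \<subseteq> - R \<and> \<beta> (- (C \<union> D)) \<le> e" for R
    using that by (simp add: \<M>_def)
  have \<M>E: "\<exists>C D. compact C \<and> compact D \<and> C \<subseteq> R \<and> D \<subseteq> - R \<and> \<beta> (- (C \<union> D)) \<le> e" if "R \<in> \<M>" "0 < e" for R e
    using that by (simp add: \<M>_def)
  have compl: "- R \<in> \<M>" if "R \<in> \<M>" for R
  proof (rule \<M>I)
    fix e :: real assume "0 < e"
    from \<M>E[OF that this] obtain C D where "compact C" "compact D" "C \<subseteq> R" "D \<subseteq> - R" "\<beta> (- (C \<union> D)) \<le> e"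
      by blast
    then show "\<exists>C D. compact C \<and> compact D \<and> C \<subseteq> - R \<and> D \<subseteq> - (- R) \<and> \<beta> (- (C \<union> D)) \<le> e"
      by (intro exI[of _ D] exI[of _ C]) (auto simp: Un_commute)
  qed
  have un: "R \<union> R' \<in> \<M>" if R: "R \<in> \<M>" "R' \<in> \<M>" for R R'
  proof (rule \<M>I)
    fix e :: real assume e: "0 < e"
    from \<M>E[OF R(1), of "e/2"] e obtain C D
      where 1: "compact C" "compact D" "C \<subseteq> R" "D \<subseteq> - R" "\<beta> (- (C \<union> D)) \<le> e/2" by auto
    from \<M>E[OF R(2), of "e/2"] e obtain C' D'
      where 2: "compact C'" "compact D'" "C' \<subseteq> R'" "D' \<subseteq> - R'" "\<beta> (- (C' \<union> D')) \<le> e/2" by auto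
    have "\<beta> (- ((C \<union> C') \<union> (D \<inter> D'))) \<le> \<beta> (- (C \<union> D) \<union> - (C' \<union> D'))"
      by (intro mono) auto
    also have "\<dots> \<le> e" using subadd[of "- (C \<union> D)" "- (C' \<union> D')"] 1(5) 2(5) by linarith
    finally have "\<beta> (- ((C \<union> C') \<union> (D \<inter> D'))) \<le> e" .
    moreover have "compact (C \<union> C')" "compact (D \<inter> D')" using 1 2 by (auto intro: compact_Un compact_Int)
    ultimately show "\<exists>C D. compact C \<and> compact D \<and> C \<subseteq> R \<union> R' \<and> D \<subseteq> - (R \<union> R') \<and> \<beta> (- (C \<union> D)) \<le> e"
      using 1(3,4) 2(3,4) by (intro exI[of _ "C \<union> C'"] exI[of _ "D \<inter> D'"]) auto
  qed
  have empty: "{} \<in> \<M>" and fst_cyl: "A \<times> UNIV \<in> \<M>" and snd_cyl: "UNIV \<times> A \<in> \<M>"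
    if A: "A \<in> sets borel" for A
  proof -
    \<comment> \<open>A cylinder over \<open>A\<close> becomes compact only after its free
      coordinate is cut down too, so both marginals are approximated even though each application
      takes one of \<open>A\<close>, \<open>A'\<close> empty. Four exceptional strips of
      \<beta>-mass at most \<open>e/4\<close> cover the complement of the compact rectangle.\<close>
    have cover: "\<exists>K L K' L'. compact K \<and> compact L \<and> compact K' \<and> compact L' \<and> K \<subseteq> A \<and> L \<subseteq> - A \<and> K' \<subseteq> A' \<and> L' \<subseteq> - A'
        \<and> \<beta> (- ((K \<union> L) \<times> (K' \<union> L'))) \<le> e"
      if A: "A \<in> sets borel" "A' \<in> sets borel" and e: "0 < e" for A A' e
    proof -
      have e4: "0 < e/4" using e by simp
      have A'': "- A \<in> sets borel" "- A' \<in> sets borel" using A by auto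
      obtain K where K: "compact K" "K \<subseteq> A" "measure \<mu> (A - K) \<le> e/4"
        by (rule compact_inner_approx[OF \<mu> A(1) e4])
      obtain L where L: "compact L" "L \<subseteq> - A" "measure \<mu> (- A - L) \<le> e/4"
        by (rule compact_inner_approx[OF \<mu> A''(1) e4])
      obtain K' where K': "compact K'" "K' \<subseteq> A'" "measure \<nu> (A' - K') \<le> e/4"
        by (rule compact_inner_approx[OF \<nu> A(2) e4])
      obtain L' where L': "compact L'" "L' \<subseteq> - A'" "measure \<nu> (- A' - L') \<le> e/4"
        by (rule compact_inner_approx[OF \<nu> A''(2) e4])
      have "A - K \<in> sets borel" "- A - L \<in> sets borel" "A' - K' \<in> sets borel" "- A' - L' \<in> sets borel"
        by (intro sets.Diff A A'' borel_compact K(1) L(1) K'(1) L'(1))+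
      then have le: "\<beta> ((A - K) \<times> UNIV) \<le> e/4" "\<beta> ((- A - L) \<times> UNIV) \<le> e/4"
        "\<beta> (UNIV \<times> (A' - K')) \<le> e/4" "\<beta> (UNIV \<times> (- A' - L')) \<le> e/4"
        using \<beta>\<mu> \<beta>\<nu> K(3) L(3) K'(3) L'(3) by (meson order_trans)+
      have "\<beta> (- ((K \<union> L) \<times> (K' \<union> L')))
          \<le> \<beta> (((A - K) \<times> UNIV \<union> (- A - L) \<times> UNIV) \<union> (UNIV \<times> (A' - K') \<union> UNIV \<times> (- A' - L')))"
        by (intro mono) auto
      also have "\<dots> \<le> \<beta> ((A - K) \<times> UNIV \<union> (- A - L) \<times> UNIV) + \<beta> (UNIV \<times> (A' - K') \<union> UNIV \<times> (- A' - L'))"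
        by (rule subadd)
      also have "\<dots> \<le> (\<beta> ((A - K) \<times> UNIV) + \<beta> ((- A - L) \<times> UNIV)) + (\<beta> (UNIV \<times> (A' - K')) + \<beta> (UNIV \<times> (- A' - L')))"
        by (intro add_mono subadd)
      also have "\<dots> \<le> e" using le by simp
      finally show ?thesis using K L K' L' by blast
    qed
    show "A \<times> UNIV \<in> \<M>"
    proof (rule \<M>I)
      fix e :: real assume "0 < e"
      from cover[OF A sets.empty_sets this] obtain K L K' L'
        where *: "compact K" "compact L" "compact K'" "compact L'" "K \<subseteq> A" "L \<subseteq> - A"
          "\<beta> (- ((K \<union> L) \<times> (K' \<union> L'))) \<le> e" by blast
      then show "\<exists>C D. compact C \<and> compact D \<and> C \<subseteq> A \<times> UNIV \<and> D \<subseteq> - (A \<times> UNIV) \<and> \<beta> (- (C \<union> D)) \<le> e"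
        by (intro exI[of _ "K \<times> (K' \<union> L')"] exI[of _ "L \<times> (K' \<union> L')"])
           (auto intro!: compact_Times compact_Un simp: Sigma_Un_distrib1[symmetric])
    qed
    show "UNIV \<times> A \<in> \<M>"
    proof (rule \<M>I)
      fix e :: real assume "0 < e"
      from cover[OF sets.empty_sets A this] obtain K L K' L'
        where *: "compact K" "compact L" "compact K'" "compact L'" "K' \<subseteq> A" "L' \<subseteq> - A"
          "\<beta> (- ((K \<union> L) \<times> (K' \<union> L'))) \<le> e" by blast
      then show "\<exists>C D. compact C \<and> compact D \<and> C \<subseteq> UNIV \<times> A \<and> D \<subseteq> - (UNIV \<times> A) \<and> \<beta> (- (C \<union> D)) \<le> e"
        by (intro exI[of _ "(K \<union> L) \<times> K'"] exI[of _ "(K \<union> L) \<times> L'"])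
           (auto intro!: compact_Times compact_Un simp: Sigma_Un_distrib2[symmetric])
    qed
    show "{} \<in> \<M>"
    proof (rule \<M>I)
      fix e :: real assume "0 < e"
      from cover[OF sets.empty_sets sets.empty_sets this] obtain K L K' L'
        where *: "compact K" "compact L" "compact K'" "compact L'"
          "\<beta> (- ((K \<union> L) \<times> (K' \<union> L'))) \<le> e" by blast
      then show "\<exists>C D. compact C \<and> compact D \<and> C \<subseteq> {} \<and> D \<subseteq> - {} \<and> \<beta> (- (C \<union> D)) \<le> e"
        by (intro exI[of _ "{}"] exI[of _ "(K \<union> L) \<times> (K' \<union> L')"])
           (auto intro!: compact_Times compact_Un)
    qed
  qed
  have alg: "algebra UNIV \<M>"
    unfolding algebra_iff_Un using empty[OF sets.empty_sets] compl un by (auto simp: Compl_eq_Diff_UNIV[symmetric])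
  then interpret \<M>: algebra UNIV \<M> .
  have times: "A \<times> B \<in> \<M>" if "A \<in> sets borel" "B \<in> sets borel" for A B
  proof -
    have "A \<times> B = (A \<times> UNIV) \<inter> (UNIV \<times> B)" by auto
    then show ?thesis using fst_cyl[OF that(1)] snd_cyl[OF that(2)] by (simp add: \<M>.Int)
  qed
  have "\<exists>m :: ('a \<times> 'a) set \<Rightarrow> ennreal. (\<forall>s \<in> \<M>. m s = ennreal (\<beta> s)) \<and> measure_space UNIV (sigma_sets UNIV \<M>) m"
  proof (rule \<M>.caratheodory_empty_continuous)
    show "positive \<M> (\<lambda>R. ennreal (\<beta> R))"
      by (simp add: positive_def fin_additive_empty[OF \<beta>])
    show "additive \<M> (\<lambda>R. ennreal (\<beta> R))"
      by (simp add: additive_def fin_additive_Un[OF \<beta>] nonneg)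
    show "ennreal (\<beta> A) \<noteq> \<infinity>" for A by simp
    fix A :: "nat \<Rightarrow> _" assume A: "range A \<subseteq> \<M>" "decseq A" "(\<Inter>i. A i) = {}"
    have small: "\<exists>n. \<beta> (A n) \<le> e" if e: "0 < e" for e
    proof -
      \<comment> \<open>The compact sets for different \<open>n\<close> are not nested, so their
        finite intersections will be used; the geometric tolerances keep the accumulated loss below
        \<open>e\<close>.\<close>
      have "\<exists>C. compact C \<and> C \<subseteq> A n \<and> \<beta> (A n - C) \<le> e * (1/2) ^ Suc n" for n
      proof -
        have "A n \<in> \<M>" "0 < e * (1/2) ^ Suc n" using A e by auto
        from \<M>E[OF this] obtain C D where *: "compact C" "C \<subseteq> A n" "D \<subseteq> - A n"
          "\<beta> (- (C \<union> D)) \<le> e * (1/2) ^ Suc n" by blast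
        have "\<beta> (A n - C) \<le> \<beta> (- (C \<union> D))" using * by (intro mono) auto
        with * show ?thesis by (meson order_trans)
      qed
      then obtain C where C: "\<And>n. compact (C n)" "\<And>n. C n \<subseteq> A n" "\<And>n. \<beta> (A n - C n) \<le> e * (1/2) ^ Suc n"
        by metis
      have "\<exists>n. (\<Inter>m\<le>n. C m) = {}"
      proof (rule ccontr)
        assume ne: "\<not> ?thesis"
        have "C 0 \<inter> (\<Inter>m\<in>UNIV. C m) \<noteq> {}"
        proof (rule compact_imp_fip_image[OF C(1)])
          show "closed (C m)" for m using C(1) by (rule compact_imp_closed)
          fix I' :: "nat set" assume "finite I'"
          then obtain n where "I' \<subseteq> {..n}" by (auto simp: finite_nat_iff_bounded_le)
          then have "(\<Inter>m\<le>n. C m) \<subseteq> C 0 \<inter> (\<Inter>m\<in>I'. C m)" by auto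
          moreover have "(\<Inter>m\<le>n. C m) \<noteq> {}" using ne by simp
          ultimately show "C 0 \<inter> (\<Inter>m\<in>I'. C m) \<noteq> {}" by (metis subset_empty)
        qed
        then obtain x where "\<And>m. x \<in> C m" by auto
        then have "x \<in> (\<Inter>i. A i)" using C(2) by blast
        then show False using A(3) by simp
      qed
      then obtain n where n: "(\<Inter>m\<le>n. C m) = {}" by blast
      have "A n \<subseteq> (\<Union>m\<le>n. A m - C m)"
      proof
        fix x assume "x \<in> A n"
        then have "\<And>m. m \<le> n \<Longrightarrow> x \<in> A m" using A(2) by (auto simp: decseq_def)
        moreover have "x \<notin> (\<Inter>m\<le>n. C m)" using n by simp
        ultimately show "x \<in> (\<Union>m\<le>n. A m - C m)" by blast
      qed
      then have "\<beta> (A n) \<le> \<beta> (\<Union>m\<le>n. A m - C m)" by (rule mono)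
      also have "\<dots> \<le> (\<Sum>m\<le>n. \<beta> (A m - C m))" by (intro fin_additive_UN_le[OF \<beta>]) simp
      also have "\<dots> \<le> (\<Sum>m\<le>n. e * (1/2) ^ Suc m)" by (intro sum_mono C)
      also have "\<dots> = e * (\<Sum>m\<le>n. (1/2) ^ Suc m)" by (simp only: sum_distrib_left)
      also have "\<dots> \<le> e * 1" using e sum_half_powers_le_1 by (intro mult_left_mono) auto
      finally show ?thesis by auto
    qed
    have "(\<lambda>n. \<beta> (A n)) \<longlonglongrightarrow> 0"
    proof (rule LIMSEQ_I)
      fix r :: real assume "0 < r"
      then obtain n where n: "\<beta> (A n) \<le> r/2" using small[of "r/2"] by auto
      have "norm (\<beta> (A m) - 0) < r" if "n \<le> m" for m
        using mono[of "A m" "A n"] decseqD[OF A(2) that] n nonneg[of "A m"] \<open>0 < r\<close> by auto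
      then show "\<exists>n. \<forall>m\<ge>n. norm (\<beta> (A m) - 0) < r" by blast
    qed
    then show "(\<lambda>n. ennreal (\<beta> (A n))) \<longlonglongrightarrow> 0"
      using tendsto_ennrealI by fastforce
  qed
  then obtain m :: "('a \<times> 'a) set \<Rightarrow> ennreal" where m: "\<And>s. s \<in> \<M> \<Longrightarrow> m s = ennreal (\<beta> s)"
    "measure_space UNIV (sigma_sets UNIV \<M>) m" by blast
  define \<gamma>0 where "\<gamma>0 = measure_of UNIV (sigma_sets UNIV \<M>) m"
  have sets0: "sets \<gamma>0 = sigma_sets UNIV \<M>"
    using m(2) unfolding \<gamma>0_def measure_space_def
    by (intro sigma_algebra.sets_measure_of_eq) auto
  have em0: "emeasure \<gamma>0 s = ennreal (\<beta> s)" if "s \<in> \<M>" for s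
  proof -
    have "emeasure \<gamma>0 s = m s"
      using m(2) that unfolding \<gamma>0_def measure_space_def
      by (intro emeasure_measure_of_sigma) (auto intro: sigma_sets.Basic)
    then show ?thesis using m(1)[OF that] by simp
  qed
  have sub: "sets (borel :: ('a \<times> 'a) measure) \<subseteq> sets \<gamma>0"
  proof -
    have "sets (borel :: ('a \<times> 'a) measure) = sigma_sets UNIV {a \<times> b | a b. a \<in> sets borel \<and> b \<in> sets borel}"
      unfolding borel_prod[symmetric] sets_pair_measure by simp
    also have "\<dots> \<subseteq> sigma_sets UNIV \<M>"
      using times by (intro sigma_sets_mono') auto
    finally show ?thesis by (simp add: sets0)
  qed
  have sp0: "space \<gamma>0 = UNIV" by (simp add: \<gamma>0_def space_measure_of_conv)
  have meas: "(\<lambda>x. x) \<in> measurable \<gamma>0 borel"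
    using sub by (auto simp: measurable_def sp0)
  \<comment> \<open>Caratheodory's measure lives on the sigma-algebra generated by
    \<open>\<M>\<close>, which contains the Borel sets; pushing forward along the identity restricts
    it to them.\<close>
  define \<gamma> where "\<gamma> = distr \<gamma>0 borel (\<lambda>x. x)"
  have em: "emeasure \<gamma> s = ennreal (\<beta> s)" if "s \<in> \<M>" "s \<in> sets borel" for s
    using em0[OF that(1)] that(2) by (simp add: \<gamma>_def emeasure_distr[OF meas] sp0)
  show thesis
  proof (rule that[of \<gamma>])
    have "finite_measure \<gamma>"
      using em[of UNIV] \<M>.top by (intro finite_measureI) (simp add: \<gamma>_def)
    then show "finite_borel_measure \<gamma>" by (simp add: finite_borel_measure_def \<gamma>_def)
    fix A B :: "'a set" assume AB: "A \<in> sets borel" "B \<in> sets borel"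
    then show "measure \<gamma> (A \<times> B) = \<beta> (A \<times> B)"
      by (simp add: measure_def em times borel_Times nonneg)
  qed
qed

section \<open>Projections of closed sets\<close>

text \<open>Given \<open>t\<close> below the outer measure
  of the projection, one cuts down the second coordinate to finitely many balls of radius
  \<open>2\<^sup>-\<^sup>n\<close> for each \<open>n\<close>, keeping the outer measure of the projection above \<open>t\<close>; total boundedness
  of the second coordinate makes the limit set a closed subset of the projection.\<close>

lemma closed_subset_of_projection:
  fixes M :: "'a::metric_space measure" and F :: "('a \<times> 'b::polish_space) set"
  assumes M: "finite_borel_measure M" and F: "closed F" and t: "t < outer_measure_of M (fst ` F)"
  obtains K where "closed K" "K \<subseteq> fst ` F" "t \<le> emeasure M K"
proof -
  note M' = finite_borel_measureD[OF M]
  interpret finite_measure M by fact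
  obtain D :: "'b set" where D: "countable D" "\<And>X. open X \<Longrightarrow> X \<noteq> {} \<Longrightarrow> \<exists>d\<in>D. d \<in> X"
    by (rule countable_dense_setE) blast
  have "D \<noteq> {}" using D(2)[of UNIV] by auto
  define q where "q = from_nat_into D"
  have q: "\<exists>k. dist (q k) y \<le> r" if r: "0 < r" for y r
  proof -
    have "ball y r \<noteq> {}" using r by simp
    then obtain d where "d \<in> D" "d \<in> ball y r" using D(2)[of "ball y r"] by auto
    moreover obtain k where "q k = d"
      using \<open>d \<in> D\<close> D(1) \<open>D \<noteq> {}\<close> unfolding q_def by (metis from_nat_into_to_nat_on)
    ultimately show ?thesis by (auto simp: dist_commute intro!: exI[of _ k])
  qed
  define V where "V j m = (\<Union>k\<le>m. cball (q k) ((1/2) ^ j))" for j m :: nat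
  \<comment> \<open>The implication for \<open>n = 0\<close> fixes the starting value of the
    recursion inside the invariant.\<close>
  have "\<exists>L. \<forall>n. (t < outer_measure_of M (fst ` L n) \<and> (n = 0 \<longrightarrow> L n = F))
      \<and> (\<exists>m. L (Suc n) = L n \<inter> UNIV \<times> V n m)"
  proof (rule dependent_nat_choice)
    show "\<exists>L. t < outer_measure_of M (fst ` L) \<and> (0 = (0::nat) \<longrightarrow> L = F)" using t by auto
    fix L :: "('a \<times> 'b) set" and n :: nat assume L: "t < outer_measure_of M (fst ` L) \<and> (n = 0 \<longrightarrow> L = F)"
    \<comment> \<open>Outer measure is continuous along increasing sequences of arbitrary sets, so
      the projections may be handled before anything is known about their measurability.\<close>
    have "(SUP m. outer_measure_of M (fst ` (L \<inter> UNIV \<times> V n m)))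
        = outer_measure_of M (\<Union>m. fst ` (L \<inter> UNIV \<times> V n m))"
    proof (rule SUP_outer_measure_of_incseq)
      show "incseq (\<lambda>m. fst ` (L \<inter> UNIV \<times> V n m))"
        by (intro monoI image_mono Int_mono Sigma_mono) (auto simp: V_def intro: order_trans)
    qed (simp add: M')
    also have "(\<Union>m. fst ` (L \<inter> UNIV \<times> V n m)) = fst ` L"
    proof -
      have "(\<Union>m. V n m) = UNIV"
      proof -
        have "y \<in> (\<Union>m. V n m)" for y using q[of "(1/2) ^ n" y] by (auto simp: V_def)
        then show ?thesis by auto
      qed
      then have "(\<Union>m. L \<inter> UNIV \<times> V n m) = L" by auto
      then show ?thesis by (metis image_UN)
    qed
    finally have "t < (SUP m. outer_measure_of M (fst ` (L \<inter> UNIV \<times> V n m)))" using L by simp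
    then obtain m where "t < outer_measure_of M (fst ` (L \<inter> UNIV \<times> V n m))"
      unfolding less_SUP_iff by blast
    then show "\<exists>L'. (t < outer_measure_of M (fst ` L') \<and> (Suc n = 0 \<longrightarrow> L' = F))
        \<and> (\<exists>m. L' = L \<inter> UNIV \<times> V n m)" by auto
  qed
  then obtain L m where L: "\<And>n. t < outer_measure_of M (fst ` L n)" "L 0 = F"
    "\<And>n. L (Suc n) = L n \<inter> UNIV \<times> V n (m n)" by metis
  have "decseq L" by (intro decseq_SucI) (use L(3) in auto)
  then have LF: "L n \<subseteq> F" for n using L(2) decseqD[of L 0 n] by simp
  have LV: "snd p \<in> V j (m j)" if "p \<in> L n" "j < n" for p j n
    using decseqD[OF \<open>decseq L\<close>, of "Suc j" n] that L(3)[of j] by auto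
  \<comment> \<open>Outer measure need not be continuous along decreasing sequences, whereas
    \<open>M\<close> is on closed sets; hence the closures. What remains is that taking closures
    does not lead out of the projection in the limit.\<close>
  define K where "K = (\<Inter>n. closure (fst ` L n))"
  have "K \<subseteq> fst ` F"
  proof
    fix x assume x: "x \<in> K"
    have "\<exists>p\<in>L n. dist (fst p) x < (1/2) ^ n" for n
    proof -
      have "x \<in> closure (fst ` L n)" using x by (simp add: K_def)
      moreover have "0 < (1/2 :: real) ^ n" by simp
      ultimately show ?thesis unfolding closure_approachable by blast
    qed
    then obtain p where p: "\<And>n. p n \<in> L n" "\<And>n. dist (fst (p n)) x < (1/2) ^ n" by metis
    define Y where "Y = closure (range (\<lambda>n. snd (p n)))"
    have "compact Y"
      unfolding compact_eq_totally_bounded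
    proof (intro conjI allI impI)
      show "complete Y" by (simp add: Y_def complete_eq_closed)
      fix e :: real assume e: "0 < e"
      then obtain j where j: "(1/2) ^ j < e"
        using real_arch_pow_inv[of e "1/2"] by auto
      \<comment> \<open>The cut by \<open>V j (m j)\<close> takes effect from
        \<open>L (Suc j)\<close> on, so the points with index at most \<open>j\<close> are added as
        centres of their own.\<close>
      define T where "T = (\<lambda>n. snd (p n)) ` {..j} \<union> q ` {..m j}"
      have "snd (p n) \<in> (\<Union>c\<in>T. cball c ((1/2) ^ j))" for n
      proof (cases "n \<le> j")
        case True
        then have "snd (p n) \<in> T" by (auto simp: T_def)
        then show ?thesis by (intro UN_I[of "snd (p n)"]) auto
      next
        case False
        then have "snd (p n) \<in> V j (m j)" using LV[OF p(1)] by simp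
        then show ?thesis by (auto simp: V_def T_def)
      qed
      moreover have "closed (\<Union>c\<in>T. cball c ((1/2) ^ j))"
        by (intro closed_UN) (auto simp: T_def)
      ultimately have "Y \<subseteq> (\<Union>c\<in>T. cball c ((1/2) ^ j))"
        unfolding Y_def by (intro closure_minimal) auto
      also have "\<dots> \<subseteq> (\<Union>c\<in>T. ball c e)" using j by (intro UN_mono) auto
      finally show "\<exists>T. finite T \<and> Y \<subseteq> (\<Union>c\<in>T. ball c e)"
        by (intro exI[of _ T]) (auto simp: T_def)
    qed
    moreover have "snd (p n) \<in> Y" for n
      unfolding Y_def using closure_subset by (metis rangeI subsetD)
    ultimately obtain y r where r: "strict_mono r" "((\<lambda>n. snd (p n)) \<circ> r) \<longlonglongrightarrow> y"
      unfolding compact_def by (metis (no_types, lifting))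
    have "(\<lambda>n. (1/2 :: real) ^ n) \<longlonglongrightarrow> 0" by (intro LIMSEQ_power_zero) auto
    then have "(\<lambda>n. fst (p n)) \<longlonglongrightarrow> x"
      by (rule metric_tendsto_imp_tendsto) (use p(2) in \<open>auto intro!: always_eventually less_imp_le\<close>)
    then have "(\<lambda>n. fst (p (r n))) \<longlonglongrightarrow> x"
      using LIMSEQ_subseq_LIMSEQ[OF _ r(1)] by (auto simp: o_def)
    with r(2) have "(\<lambda>n. (fst (p (r n)), snd (p (r n)))) \<longlonglongrightarrow> (x, y)"
      by (intro tendsto_Pair) (auto simp: o_def)
    moreover have "(fst (p (r n)), snd (p (r n))) \<in> F" for n using p(1) LF by auto
    ultimately have "(x, y) \<in> F" using F by (meson closed_sequentially)
    then show "x \<in> fst ` F" by force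
  qed
  moreover have "t \<le> emeasure M K"
  proof -
    have "(INF n. emeasure M (closure (fst ` L n))) = emeasure M K"
      unfolding K_def
    proof (rule INF_emeasure_decseq)
      show "decseq (\<lambda>n. closure (fst ` L n))"
        using \<open>decseq L\<close> by (auto simp: decseq_def intro!: closure_mono image_mono)
    qed (auto simp: M' emeasure_finite)
    moreover have "t \<le> emeasure M (closure (fst ` L n))" for n
    proof -
      have "t \<le> outer_measure_of M (fst ` L n)" using L(1)[of n] by simp
      also have "\<dots> \<le> outer_measure_of M (closure (fst ` L n))"
        by (intro outer_measure_of_mono closure_subset)
      finally show ?thesis by (simp add: M')
    qed
    ultimately show ?thesis by (metis INF_greatest)
  qed
  moreover have "closed K" by (auto simp: K_def)
  ultimately show thesis by (intro that)
qed

text \<open>The projection is squeezed between a countable union \<open>S\<close> of closed subsets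
  and a measurable hull \<open>E\<close>. Both have the outer measure of the projection as their
  measure, so \<open>E - S\<close> is null.\<close>

lemma projection_in_completion:
  fixes M :: "'a::metric_space measure" and F :: "('a \<times> 'b::polish_space) set"
  assumes M: "finite_borel_measure M" and F: "closed F"
  shows "fst ` F \<in> sets (completion M)"
proof -
  note M' = finite_borel_measureD[OF M]
  interpret finite_measure M by fact
  obtain E where E: "E \<in> sets M" "fst ` F \<subseteq> E" "outer_measure_of M (fst ` F) = emeasure M E"
    using outer_measure_of_attain[of "fst ` F" M] by (auto simp: M')
  have "\<exists>K. closed K \<and> K \<subseteq> fst ` F \<and> measure M E - 1 / Suc n \<le> measure M K" for n
  \<comment> \<open>A strict inequality below the outer measure in \<open>ennreal\<close> is needed,
    and it can fail when the bound is negative and truncates to 0; then the empty set does the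
    job.\<close>
  proof (cases "measure M E - 1 / Suc n < 0")
    case True
    then show ?thesis by (intro exI[of _ "{}"]) auto
  next
    case False
    moreover have "0 < 1 / real (Suc n)" by simp
    ultimately have "0 < measure M E" "measure M E - 1 / Suc n < measure M E" by linarith+
    then have "ennreal (measure M E - 1 / Suc n) < outer_measure_of M (fst ` F)"
      unfolding E(3) emeasure_eq_measure by (rule ennreal_lessI)
    then obtain K where "closed K" "K \<subseteq> fst ` F" "ennreal (measure M E - 1 / Suc n) \<le> emeasure M K"
      by (rule closed_subset_of_projection[OF M F])
    then show ?thesis by (auto simp: emeasure_eq_measure)
  qed
  then obtain K where K: "\<And>n. closed (K n)" "\<And>n. K n \<subseteq> fst ` F"
    "\<And>n. measure M E - 1 / Suc n \<le> measure M (K n)" by metis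
  define S where "S = (\<Union>n. K n)"
  have KM: "K n \<in> sets M" for n using K(1) by (simp add: M')
  then have S: "S \<in> sets M" by (auto simp: S_def)
  have "measure M (E - S) \<le> 1 / Suc n" for n
  proof -
    have "measure M (E - S) \<le> measure M (E - K n)"
      using E(1) KM by (intro finite_measure_mono) (auto simp: S_def)
    also have "\<dots> = measure M E - measure M (K n)"
      using E(1,2) KM K(2)[of n] by (intro finite_measure_Diff) (blast+)
    finally show ?thesis using K(3)[of n] by linarith
  qed
  moreover have "(\<lambda>n. 1 / real (Suc n)) \<longlonglongrightarrow> 0"
    using LIMSEQ_inverse_real_of_nat by (simp add: inverse_eq_divide)
  ultimately have "measure M (E - S) \<le> 0"
    by (intro LIMSEQ_le_const[of "\<lambda>n. 1 / real (Suc n)"]) auto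
  then have "measure M (E - S) = 0" by (simp add: measure_le_0_iff)
  then have null: "E - S \<in> null_sets M"
    using E(1) S by (auto simp: null_sets_def emeasure_eq_measure)
  have eq: "fst ` F = S \<union> (fst ` F - S)" using K(2) by (auto simp: S_def)
  have "fst ` F - S \<subseteq> E - S" using E(2) by blast
  then show ?thesis by (rule sets_completionI[OF eq _ null S])
qed

lemma cthick_in_completion:
  fixes M :: "'a::polish_space measure"
  assumes "finite_borel_measure M" "closed A"
  shows "cthick A e \<in> sets (completion M)"
proof -
  have "closed (UNIV \<times> A \<inter> {p :: 'a \<times> 'a. dist (fst p) (snd p) \<le> e})"
    using assms(2) by (intro closed_Int closed_Times closed_Collect_le continuous_intros) auto
  moreover have "cthick A e = fst ` (UNIV \<times> A \<inter> {p :: 'a \<times> 'a. dist (fst p) (snd p) \<le> e})"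
    by (force simp: cthick_def)
  ultimately show ?thesis using projection_in_completion[OF assms(1)] by simp
qed

section \<open>From partial couplings to couplings\<close>

text \<open>Finite additivity yields vanishing only on rectangles that miss \<open>S\<close>. Since
  \<open>S\<close> is closed and the topology has a countable basis, \<open>- S\<close> is a
  countable union of such rectangles, and the countably additive extension is null on it.\<close>

lemma partial_coupling_on_closed_relation:
  fixes \<mu> \<nu> :: "'a::polish_space measure" and S :: "('a \<times> 'a) set"
  assumes \<mu>: "finite_borel_measure \<mu>" and \<nu>: "finite_borel_measure \<nu>" and c: "0 \<le> c"
    and S: "closed S"
    and hall: "\<And>B U. B \<in> sets borel \<Longrightarrow> U \<in> sets borel \<Longrightarrow> {x. \<exists>y\<in>B. (x, y) \<in> S} \<subseteq> U
                  \<Longrightarrow> measure \<nu> B \<le> measure \<mu> U + c"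
  obtains \<gamma> where "finite_borel_measure \<gamma>" "measure \<gamma> (- S) = 0" "measure \<nu> UNIV - c \<le> measure \<gamma> UNIV"
    "\<And>A. A \<in> sets borel \<Longrightarrow> measure \<gamma> (A \<times> UNIV) \<le> measure \<mu> A"
    "\<And>B. B \<in> sets borel \<Longrightarrow> measure \<gamma> (UNIV \<times> B) \<le> measure \<nu> B"
proof -
  obtain \<beta> where \<beta>: "fin_additive \<beta>" "measure \<nu> UNIV - c \<le> \<beta> UNIV"
    "\<And>A. A \<in> sets borel \<Longrightarrow> \<beta> (A \<times> UNIV) \<le> measure \<mu> A"
    "\<And>B. B \<in> sets borel \<Longrightarrow> \<beta> (UNIV \<times> B) \<le> measure \<nu> B"
    "\<And>A B. A \<in> sets borel \<Longrightarrow> B \<in> sets borel \<Longrightarrow> (A \<times> B) \<inter> S = {} \<Longrightarrow> \<beta> (A \<times> B) = 0"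
    by (rule fin_additive_partial_coupling[OF \<mu> \<nu> c hall]) auto
  obtain \<gamma> where \<gamma>: "finite_borel_measure \<gamma>"
    "\<And>A B. A \<in> sets borel \<Longrightarrow> B \<in> sets borel \<Longrightarrow> measure \<gamma> (A \<times> B) = \<beta> (A \<times> B)"
    using fin_additive_extends_to_measure[OF \<mu> \<nu> \<beta>(1,3,4)] by blast
  note \<gamma>' = finite_borel_measureD[OF \<gamma>(1)]
  interpret \<gamma>: finite_measure \<gamma> by fact
  obtain \<B> :: "'a set set" where \<B>: "countable \<B>" "topological_basis \<B>"
    using ex_countable_basis by blast
  define \<R> where "\<R> = {(A, B). A \<in> \<B> \<and> B \<in> \<B> \<and> (A \<times> B) \<inter> S = {}}"
  have "\<R> \<subseteq> \<B> \<times> \<B>" by (auto simp: \<R>_def)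
  then have cnt: "countable \<R>" by (rule countable_subset) (intro countable_SIGMA \<B>(1))
  have cover: "- S = (\<Union>(A, B)\<in>\<R>. A \<times> B)"
  proof (intro set_eqI iffI)
    fix p assume "p \<in> - S"
    moreover have "open (- S)" using S by (simp add: open_Compl)
    ultimately obtain A B where AB: "open A" "open B" "p \<in> A \<times> B" "A \<times> B \<subseteq> - S"
      by (auto elim: open_prod_elim)
    obtain A' where A': "A' \<in> \<B>" "fst p \<in> A'" "A' \<subseteq> A"
      using topological_basisE[OF \<B>(2) AB(1), of "fst p"] AB(3) by (metis mem_Times_iff)
    obtain B' where B': "B' \<in> \<B>" "snd p \<in> B'" "B' \<subseteq> B"
      using topological_basisE[OF \<B>(2) AB(2), of "snd p"] AB(3) by (metis mem_Times_iff)
    have "(A' \<times> B') \<inter> S = {}" using A' B' AB(4) by blast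
    then have "(A', B') \<in> \<R>" "p \<in> A' \<times> B'" using A' B' by (auto simp: \<R>_def mem_Times_iff)
    then show "p \<in> (\<Union>(A, B)\<in>\<R>. A \<times> B)" by blast
  qed (auto simp: \<R>_def)
  have "A \<times> B \<in> null_sets \<gamma>" if "(A, B) \<in> \<R>" for A B
  proof -
    have "A \<in> sets borel" "B \<in> sets borel"
      using that \<B>(2) by (auto simp: \<R>_def topological_basis_open)
    moreover from this have "measure \<gamma> (A \<times> B) = 0"
      using \<gamma>(2) \<beta>(5) that by (auto simp: \<R>_def)
    ultimately show ?thesis
      by (simp add: null_sets_def \<gamma>' borel_Times \<gamma>.emeasure_eq_measure)
  qed
  then have "(\<Union>(A, B)\<in>\<R>. A \<times> B) \<in> null_sets \<gamma>"
    using cnt by (intro null_sets_UN') auto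
  then have "measure \<gamma> (- S) = 0" by (simp add: cover measure_def null_setsD1)
  moreover have "measure \<nu> UNIV - c \<le> measure \<gamma> UNIV"
    using \<gamma>(2)[of UNIV UNIV] \<beta>(2) by simp
  ultimately show thesis
    using \<beta>(3,4) \<gamma> by (intro that[of \<gamma>]) auto
qed

lemma measure_plus_exists:
  fixes M N :: "'a measure"
  assumes [simp]: "sets N = sets M"
  obtains L where "sets L = sets M" "\<And>A. A \<in> sets M \<Longrightarrow> emeasure L A = emeasure M A + emeasure N A"
proof
  let ?f = "\<lambda>A. emeasure M A + emeasure N A"
  let ?L = "measure_of (space M) (sets M) ?f"
  show "sets ?L = sets M" by simp
  show "emeasure ?L A = ?f A" if "A \<in> sets M" for A
  proof (rule emeasure_measure_of_sigma[OF sets.sigma_algebra_axioms _ _ that])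
    show "positive (sets M) ?f" by (simp add: positive_def)
    show "countably_additive (sets M) ?f"
    proof (rule countably_additiveI)
      fix A :: "nat \<Rightarrow> 'a set" assume "range A \<subseteq> sets M" "disjoint_family A"
      then show "(\<Sum>i. ?f (A i)) = ?f (\<Union>i. A i)"
        by (subst suminf_add[symmetric]) (auto simp: suminf_emeasure)
    qed
  qed
qed

text \<open>The remainders \<open>P\<close> and \<open>Q\<close> of \<mu> and \<nu> have masses
  \<open>p \<le> q\<close>. The product of \<open>P\<close> and \<open>Q\<close> divided by
  \<open>q\<close> has first marginal \<open>P\<close> and second marginal \<open>p / q\<close>
  times \<open>Q\<close>, so adding it to \<gamma> completes the first marginal and keeps the second
  below \<nu>. For \<open>q = 0\<close> the factor \<open>1 / q\<close> is 0, which is right because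
  \<open>p\<close> vanishes as well.\<close>

lemma partial_coupling_completion:
  fixes \<mu> \<nu> :: "'a::second_countable_topology measure"
  assumes \<mu>: "finite_borel_measure \<mu>" and \<nu>: "finite_borel_measure \<nu>"
    and mass: "measure \<mu> UNIV \<le> measure \<nu> UNIV"
    and \<gamma>: "finite_borel_measure \<gamma>"
    and \<gamma>\<mu>: "\<And>A. A \<in> sets borel \<Longrightarrow> measure \<gamma> (A \<times> UNIV) \<le> measure \<mu> A"
    and \<gamma>\<nu>: "\<And>B. B \<in> sets borel \<Longrightarrow> measure \<gamma> (UNIV \<times> B) \<le> measure \<nu> B"
  obtains \<alpha> where "finite_borel_measure \<alpha>" "distr \<alpha> borel fst = \<mu>"
    "\<And>B. B \<in> sets borel \<Longrightarrow> measure (distr \<alpha> borel snd) B \<le> measure \<nu> B"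
    "\<And>T. T \<in> sets borel \<Longrightarrow> measure \<alpha> T \<le> measure \<gamma> T + (measure \<mu> UNIV - measure \<gamma> UNIV)"
proof -
  note \<mu>' = finite_borel_measureD[OF \<mu>] and \<nu>' = finite_borel_measureD[OF \<nu>] and \<gamma>' = finite_borel_measureD[OF \<gamma>]
  interpret \<mu>: finite_measure \<mu> by fact
  interpret \<nu>: finite_measure \<nu> by fact
  interpret \<gamma>: finite_measure \<gamma> by fact
  have fst_m: "fst \<in> measurable \<gamma> borel" and snd_m: "snd \<in> measurable \<gamma> borel"
    unfolding measurable_cong_sets[OF \<gamma>'(2) refl]
    by (auto intro!: borel_measurable_continuous_onI continuous_intros)
  have vim: "fst -` A = A \<times> UNIV" "snd -` A = UNIV \<times> A" for A :: "'a set" by auto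
  have d1: "emeasure (distr \<gamma> borel fst) A = ennreal (measure \<gamma> (A \<times> UNIV))" if "A \<in> sets borel" for A
    using that by (simp add: emeasure_distr[OF fst_m] \<gamma>' vim \<gamma>.emeasure_eq_measure)
  have d2: "emeasure (distr \<gamma> borel snd) A = ennreal (measure \<gamma> (UNIV \<times> A))" if "A \<in> sets borel" for A
    using that by (simp add: emeasure_distr[OF snd_m] \<gamma>' vim \<gamma>.emeasure_eq_measure)
  define P where "P = diff_measure \<mu> (distr \<gamma> borel fst)"
  define Q where "Q = diff_measure \<nu> (distr \<gamma> borel snd)"
  have P: "emeasure P A = ennreal (measure \<mu> A - measure \<gamma> (A \<times> UNIV))" if "A \<in> sets borel" for A
  proof -
    have "emeasure P A = emeasure \<mu> A - emeasure (distr \<gamma> borel fst) A"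
      unfolding P_def
      using that \<gamma>\<mu> d1 \<mu>' \<mu>.emeasure_eq_measure \<gamma>.finite_measure_distr[OF fst_m]
      by (intro emeasure_diff_measure) (auto intro!: ennreal_leI)
    then show ?thesis
      using d1[OF that] by (simp add: \<mu>.emeasure_eq_measure ennreal_minus)
  qed
  have Q: "emeasure Q A = ennreal (measure \<nu> A - measure \<gamma> (UNIV \<times> A))" if "A \<in> sets borel" for A
  proof -
    have "emeasure Q A = emeasure \<nu> A - emeasure (distr \<gamma> borel snd) A"
      unfolding Q_def
      using that \<gamma>\<nu> d2 \<nu>' \<nu>.emeasure_eq_measure \<gamma>.finite_measure_distr[OF snd_m]
      by (intro emeasure_diff_measure) (auto intro!: ennreal_leI)
    then show ?thesis
      using d2[OF that] by (simp add: \<nu>.emeasure_eq_measure ennreal_minus)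
  qed
  have PQ_sets [measurable_cong]: "sets P = sets borel" "sets Q = sets borel"
    by (simp_all add: P_def Q_def \<mu>' \<nu>')
  have PQ_space: "space P = UNIV" "space Q = UNIV" by (simp_all add: P_def Q_def \<mu>' \<nu>')
  interpret P: finite_measure P by (rule finite_measureI) (simp add: PQ_space P)
  interpret Q: finite_measure Q by (rule finite_measureI) (simp add: PQ_space Q)
  define p where "p = measure \<mu> UNIV - measure \<gamma> UNIV"
  define q where "q = measure \<nu> UNIV - measure \<gamma> UNIV"
  have pq: "0 \<le> p" "p \<le> q" using \<gamma>\<mu>[of UNIV] mass by (auto simp: p_def q_def)
  let ?N = "scale_measure (ennreal (1 / q)) (P \<Otimes>\<^sub>M Q)"
  have "sets ?N = sets (borel \<Otimes>\<^sub>M borel :: ('a \<times> 'a) measure)"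
    using sets_pair_measure_cong[OF PQ_sets] by simp
  then have "sets ?N = sets \<gamma>" by (simp only: borel_prod \<gamma>')
  then obtain \<alpha> where \<alpha>: "sets \<alpha> = sets \<gamma>"
    "\<And>T. T \<in> sets \<gamma> \<Longrightarrow> emeasure \<alpha> T = emeasure \<gamma> T + emeasure ?N T"
    by (rule measure_plus_exists) (rule that)
  have \<alpha>_rect: "emeasure \<alpha> (A \<times> B) = ennreal (measure \<gamma> (A \<times> B)
      + (measure \<mu> A - measure \<gamma> (A \<times> UNIV)) * (measure \<nu> B - measure \<gamma> (UNIV \<times> B)) / q)"
    if "A \<in> sets borel" "B \<in> sets borel" for A B
  proof -
    have "emeasure (P \<Otimes>\<^sub>M Q) (A \<times> B) = emeasure P A * emeasure Q B"
      using that by (intro Q.emeasure_pair_measure_Times) (auto simp: PQ_sets)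
    then have "emeasure \<alpha> (A \<times> B) = ennreal (measure \<gamma> (A \<times> B)) + ennreal (1 / q) *
       (ennreal (measure \<mu> A - measure \<gamma> (A \<times> UNIV)) * ennreal (measure \<nu> B - measure \<gamma> (UNIV \<times> B)))"
      using \<alpha>(2)[of "A \<times> B"] that by (simp add: \<gamma>' borel_Times P Q \<gamma>.emeasure_eq_measure)
    also have "\<dots> = ennreal (measure \<gamma> (A \<times> B) + 1 / q *
       ((measure \<mu> A - measure \<gamma> (A \<times> UNIV)) * (measure \<nu> B - measure \<gamma> (UNIV \<times> B))))"
      using \<gamma>\<mu>[OF that(1)] \<gamma>\<nu>[OF that(2)] pq
      by (simp add: mult_nonneg_nonneg flip: ennreal_mult ennreal_plus)
    finally show ?thesis by simp
  qed
  have fst_cyl: "emeasure \<alpha> (A \<times> UNIV) = emeasure \<mu> A" if A: "A \<in> sets borel" for A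
  proof -
    \<comment> \<open>Monotonicity of the remainder, obtained from domination on the complement of
      \<open>A\<close>. It serves the case \<open>q = 0\<close>, where it forces the remainder on
      \<open>A\<close> to be 0.\<close>
    have "measure \<mu> A - measure \<gamma> (A \<times> UNIV) \<le> p"
    proof -
      have "measure \<gamma> (UNIV - A \<times> UNIV) = measure \<gamma> UNIV - measure \<gamma> (A \<times> UNIV)"
        using A \<gamma>.finite_measure_compl[of "A \<times> UNIV"] by (simp add: \<gamma>' borel_Times)
      moreover have "measure \<mu> (UNIV - A) = measure \<mu> UNIV - measure \<mu> A"
        using A \<mu>.finite_measure_compl[of A] by (simp add: \<mu>')
      moreover have "UNIV - A \<times> UNIV = (UNIV - A) \<times> (UNIV :: 'a set)" by auto
      moreover have "measure \<gamma> ((UNIV - A) \<times> UNIV) \<le> measure \<mu> (UNIV - A)"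
        using A by (intro \<gamma>\<mu>) auto
      ultimately show ?thesis by (simp add: p_def)
    qed
    then have "(measure \<mu> A - measure \<gamma> (A \<times> UNIV)) * q / q = measure \<mu> A - measure \<gamma> (A \<times> UNIV)"
      using pq \<gamma>\<mu>[OF A] by (cases "q = 0") auto
    then show ?thesis
      using \<alpha>_rect[OF A, of UNIV] by (simp add: q_def[symmetric] \<mu>.emeasure_eq_measure)
  qed
  have snd_cyl: "emeasure \<alpha> (UNIV \<times> B) \<le> emeasure \<nu> B" if B: "B \<in> sets borel" for B
  proof -
    have "p * (measure \<nu> B - measure \<gamma> (UNIV \<times> B)) / q \<le> measure \<nu> B - measure \<gamma> (UNIV \<times> B)"
    proof (cases "q = 0")
      case False
      then have "p / q \<le> 1" using pq by simp
      then show ?thesis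
        using \<gamma>\<nu>[OF B] mult_right_mono[of "p / q" 1 "measure \<nu> B - measure \<gamma> (UNIV \<times> B)"] by simp
    qed (use \<gamma>\<nu>[OF B] in simp)
    then show ?thesis
      using \<alpha>_rect[OF _ B, of UNIV]
      by (simp add: p_def[symmetric] \<nu>.emeasure_eq_measure)
  qed
  have sp\<alpha>: "space \<alpha> = UNIV" using sets_eq_imp_space_eq[OF \<alpha>(1)] by (simp add: \<gamma>')
  interpret \<alpha>: finite_measure \<alpha>
    using fst_cyl[of UNIV] by (intro finite_measureI) (simp add: sp\<alpha> \<mu>.emeasure_finite)
  have \<alpha>fst: "fst \<in> measurable \<alpha> borel" and \<alpha>snd: "snd \<in> measurable \<alpha> borel"
    using fst_m snd_m unfolding measurable_cong_sets[OF \<alpha>(1) refl] by auto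
  show thesis
  proof (rule that[of \<alpha>])
    show "finite_borel_measure \<alpha>"
      using \<alpha>.finite_measure_axioms \<alpha>(1) by (simp add: finite_borel_measure_def \<gamma>')
    show "distr \<alpha> borel fst = \<mu>"
      by (rule measure_eqI) (simp_all add: \<mu>' emeasure_distr[OF \<alpha>fst] sp\<alpha> vim fst_cyl)
    show "measure (distr \<alpha> borel snd) B \<le> measure \<nu> B" if "B \<in> sets borel" for B
      using snd_cyl[OF that] that
      by (simp add: measure_distr[OF \<alpha>snd] sp\<alpha> vim \<alpha>.emeasure_eq_measure \<nu>.emeasure_eq_measure)
    show "measure \<alpha> T \<le> measure \<gamma> T + (measure \<mu> UNIV - measure \<gamma> UNIV)" if T: "T \<in> sets borel" for T
    proof -
      \<comment> \<open>As \<alpha> has total mass \<mu>(Z), a lower bound on the complement of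
        \<open>T\<close> is an upper bound on \<open>T\<close>; the product term need not be
        evaluated on \<open>T\<close>.\<close>
      have "measure \<alpha> (UNIV - T) \<ge> measure \<gamma> (UNIV - T)"
        using \<alpha>(2)[of "UNIV - T"] T by (simp add: \<gamma>' \<alpha>.emeasure_eq_measure \<gamma>.emeasure_eq_measure
            flip: ennreal_le_iff)
      moreover have "measure \<alpha> (UNIV - T) = measure \<alpha> UNIV - measure \<alpha> T"
        using \<alpha>.finite_measure_compl[of T] T by (simp add: sp\<alpha> \<alpha>(1) \<gamma>')
      moreover have "measure \<gamma> (UNIV - T) = measure \<gamma> UNIV - measure \<gamma> T"
        using \<gamma>.finite_measure_compl[of T] T by (simp add: \<gamma>')
      moreover have "measure \<alpha> UNIV = measure \<mu> UNIV"
        using fst_cyl[of UNIV] by (simp add: measure_def)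
      ultimately show ?thesis by linarith
    qed
  qed
qed

section \<open>Prokhorov distance and couplings\<close>

lemma finite_borel_measure_distr:
  assumes "finite_borel_measure M" "f \<in> borel_measurable borel"
  shows "finite_borel_measure (distr M borel f)"
proof -
  note M' = finite_borel_measureD[OF assms(1)]
  interpret finite_measure M by fact
  have "f \<in> measurable M borel" using assms(2) measurable_cong_sets[OF M'(2) refl] by blast
  then show ?thesis by (simp add: finite_borel_measure_def finite_measure_distr)
qed

lemma measure_distr_fst_snd:
  fixes \<alpha> :: "('a::topological_space \<times> 'a) measure"
  assumes "finite_borel_measure \<alpha>" "A \<in> sets borel"
  shows "measure (distr \<alpha> borel fst) A = measure \<alpha> (A \<times> UNIV)"
    and "measure (distr \<alpha> borel snd) A = measure \<alpha> (UNIV \<times> A)"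
proof -
  note \<alpha>' = finite_borel_measureD[OF assms(1)]
  have m: "fst \<in> measurable \<alpha> borel" "snd \<in> measurable \<alpha> borel"
    unfolding measurable_cong_sets[OF \<alpha>'(2) refl]
    by (auto intro!: borel_measurable_continuous_onI continuous_intros)
  have vim: "fst -` A = A \<times> UNIV" "snd -` A = UNIV \<times> A" by auto
  show "measure (distr \<alpha> borel fst) A = measure \<alpha> (A \<times> UNIV)"
    "measure (distr \<alpha> borel snd) A = measure \<alpha> (UNIV \<times> A)"
    using assms(2) by (simp_all add: measure_distr m \<alpha>' vim)
qed

lemma finite_borel_measure_marginals:
  fixes \<alpha> :: "('a::topological_space \<times> 'a) measure"
  assumes "finite_borel_measure \<alpha>"
  shows "finite_borel_measure (distr \<alpha> borel fst)" "finite_borel_measure (distr \<alpha> borel snd)"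
  by (intro finite_borel_measure_distr[OF assms] borel_measurable_continuous_onI continuous_intros)+

lemma abs_measure_diff_le_tv_dist:
  assumes M: "finite_borel_measure M" and N: "finite_borel_measure N" and A: "A \<in> sets borel"
  shows "\<bar>measure M A - measure N A\<bar> \<le> tv_dist M N"
  unfolding tv_dist_def
proof (rule cSUP_upper[OF A])
  interpret M: finite_measure M using M by (simp add: finite_borel_measure_def)
  interpret N: finite_measure N using N by (simp add: finite_borel_measure_def)
  show "bdd_above ((\<lambda>A. \<bar>measure M A - measure N A\<bar>) ` sets borel)"
  proof (rule bdd_aboveI2)
    fix A :: "'a set"
    show "\<bar>measure M A - measure N A\<bar> \<le> measure M (space M) + measure N (space N)"
      using M.bounded_measure[of A] N.bounded_measure[of A] measure_nonneg[of M A] measure_nonneg[of N A]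
      by linarith
  qed
qed

lemma tv_dist_self [simp]: "tv_dist M M = 0"
proof -
  have "sets (borel :: 'a measure) \<noteq> {}" by blast
  then show ?thesis by (simp add: tv_dist_def)
qed

text \<open>Domination on the complement of \<open>A\<close> bounds the gap on \<open>A\<close> by
  the gap in total mass.\<close>

lemma tv_dist_le_mass_diff:
  assumes M: "finite_borel_measure M" and N: "finite_borel_measure N"
    and le: "\<And>A. A \<in> sets borel \<Longrightarrow> measure M A \<le> measure N A"
  shows "tv_dist M N \<le> measure N UNIV - measure M UNIV"
  unfolding tv_dist_def
proof (rule cSUP_least)
  show "sets (borel :: 'a measure) \<noteq> {}" by blast
  note M' = finite_borel_measureD[OF M] and N' = finite_borel_measureD[OF N]
  interpret M: finite_measure M by fact
  interpret N: finite_measure N by fact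
  fix A :: "'a set" assume A: "A \<in> sets borel"
  have "measure M (UNIV - A) = measure M UNIV - measure M A"
    "measure N (UNIV - A) = measure N UNIV - measure N A"
    using A M.finite_measure_compl[of A] N.finite_measure_compl[of A] by (simp_all add: M' N')
  moreover have "measure M (UNIV - A) \<le> measure N (UNIV - A)" using A by (intro le) auto
  ultimately show "\<bar>measure M A - measure N A\<bar> \<le> measure N UNIV - measure M UNIV"
    using le[OF A] by simp
qed

text \<open>The complement of the support is a union of null balls; the Lindelof property makes this
  union countable.\<close>

lemma Compl_msupp_null:
  fixes M :: "'a::polish_space measure"
  assumes M: "finite_borel_measure M"
  shows "- msupp M \<in> null_sets M"
proof -
  note M' = finite_borel_measureD[OF M]
  define \<F> where "\<F> = {ball z r | z r. 0 < r \<and> emeasure M (ball z r) = 0}"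
  have "- msupp M = \<Union>\<F>"
  proof (intro set_eqI iffI)
    fix z assume "z \<in> - msupp M"
    then obtain r where "0 < r" "emeasure M (ball z r) = 0" by (auto simp: msupp_def)
    then have "ball z r \<in> \<F>" "z \<in> ball z r" by (auto simp: \<F>_def)
    then show "z \<in> \<Union>\<F>" by blast
  next
    fix x assume "x \<in> \<Union>\<F>"
    then obtain z r where *: "emeasure M (ball z r) = 0" "x \<in> ball z r" by (auto simp: \<F>_def)
    then obtain s where s: "0 < s" "ball x s \<subseteq> ball z r" by (meson openE open_ball)
    have "emeasure M (ball x s) \<le> emeasure M (ball z r)"
      using s(2) by (intro emeasure_mono) (auto simp: M')
    then show "x \<in> - msupp M" using s(1) * by (auto simp: msupp_def)
  qed
  moreover obtain \<F>' where \<F>': "\<F>' \<subseteq> \<F>" "countable \<F>'" "\<Union>\<F>' = \<Union>\<F>"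
    by (rule Lindelof[of \<F>]) (auto simp: \<F>_def)
  moreover have "(\<Union>T\<in>\<F>'. T) \<in> null_sets M"
    using \<F>' by (intro null_sets_UN') (auto simp: \<F>_def null_sets_def M')
  ultimately show ?thesis by simp
qed

section \<open>Thickenings of compact sets\<close>

text \<open>Distances to a compact set are attained, so its thickenings are sublevel sets of one
  continuous function; closedness and continuity from above in the radius follow. The empty set is
  excluded because \<open>infdist\<close> to it is 0 by convention.\<close>

lemma cthick_compact:
  fixes K :: "'a::metric_space set"
  assumes "compact K" "K \<noteq> {}"
  shows "cthick K e = {z. infdist z K \<le> e}"
proof (intro set_eqI iffI)
  fix z assume "z \<in> cthick K e"
  then show "z \<in> {z. infdist z K \<le> e}" by (auto simp: cthick_def intro: infdist_le2)
next
  fix z assume z: "z \<in> {z. infdist z K \<le> e}"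
  have "continuous_on K (dist z)" by (intro continuous_intros)
  then obtain a where a: "a \<in> K" "\<And>y. y \<in> K \<Longrightarrow> dist z a \<le> dist z y"
    using continuous_attains_inf[OF assms] by blast
  then have "dist z a \<le> infdist z K"
    unfolding infdist_notempty[OF assms(2)] by (intro cINF_greatest assms(2))
  also have "\<dots> \<le> e" using z by simp
  finally show "z \<in> cthick K e" using a(1) by (auto simp: cthick_def)
qed

lemma closed_cthick_compact:
  fixes K :: "'a::metric_space set"
  assumes "compact K" shows "closed (cthick K e)"
proof (cases "K = {}")
  case False
  then show ?thesis
    unfolding cthick_compact[OF assms False]
    by (intro closed_Collect_le continuous_intros)
qed (simp add: cthick_def)

lemma INT_cthick_compact:
  fixes K :: "'a::metric_space set"
  assumes "compact K"
  shows "(\<Inter>n. cthick K (e + 1 / Suc n)) = cthick K e"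
proof (cases "K = {}")
  case False
  have "(\<forall>n. x \<le> e + 1 / Suc n) \<longleftrightarrow> x \<le> e" for x
  proof
    assume le: "\<forall>n. x \<le> e + 1 / Suc n"
    have "(\<lambda>n. e + 1 / Suc n) \<longlonglongrightarrow> e + 0"
      using LIMSEQ_inverse_real_of_nat by (intro tendsto_intros) (simp add: inverse_eq_divide)
    from LIMSEQ_le_const[OF this, of x] show "x \<le> e" using le by auto
  qed (auto intro: add_increasing2)
  then show ?thesis
    unfolding cthick_compact[OF assms False] by auto
qed (simp add: cthick_def)

lemma cthick_mono:
  assumes "A \<subseteq> B" "d \<le> e" shows "cthick A d \<subseteq> cthick B e"
proof
  fix z assume "z \<in> cthick A d"
  then obtain a where "a \<in> A" "dist z a \<le> d" by (auto simp: cthick_def)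
  then have "a \<in> B" "dist z a \<le> e" using assms by auto
  then show "z \<in> cthick B e" by (auto simp: cthick_def)
qed

section \<open>The infimum defining the Prokhorov distance\<close>

definition prokhorov_admissible :: "'a::metric_space measure \<Rightarrow> 'a measure \<Rightarrow> real set" where
  "prokhorov_admissible \<mu> \<nu> = {e. e > 0 \<and> (\<forall>A. closed A \<longrightarrow>
       measure \<mu> A \<le> measure (completion \<nu>) (cthick A e) + e \<and>
       measure \<nu> A \<le> measure (completion \<mu>) (cthick A e) + e)}"

lemma prokhorov_dist_eq_Inf: "prokhorov_dist \<mu> \<nu> = Inf (prokhorov_admissible \<mu> \<nu>)"
  by (simp add: prokhorov_dist_def prokhorov_admissible_def)

lemma bdd_below_prokhorov_admissible: "bdd_below (prokhorov_admissible \<mu> \<nu>)"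
  by (rule bdd_belowI[of _ 0]) (simp add: prokhorov_admissible_def)

lemma prokhorov_admissible_nonempty:
  assumes "finite_borel_measure \<mu>" "finite_borel_measure \<nu>"
  shows "prokhorov_admissible \<mu> \<nu> \<noteq> {}"
proof -
  interpret \<mu>: finite_measure \<mu> using assms by (simp add: finite_borel_measure_def)
  interpret \<nu>: finite_measure \<nu> using assms by (simp add: finite_borel_measure_def)
  \<comment> \<open>The total masses make both inequalities trivial; the summand 1 ensures
    positivity when both measures are zero.\<close>
  let ?e = "measure \<mu> (space \<mu>) + measure \<nu> (space \<nu>) + 1"
  have "measure \<mu> A \<le> measure (completion \<nu>) B + ?e" "measure \<nu> A \<le> measure (completion \<mu>) B + ?e" for A B
    using \<mu>.bounded_measure[of A] \<nu>.bounded_measure[of A] measure_nonneg[of "completion \<nu>" B]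
      measure_nonneg[of "completion \<mu>" B] measure_nonneg[of \<mu> "space \<mu>"] measure_nonneg[of \<nu> "space \<nu>"]
    by linarith+
  moreover have "0 < ?e" by (simp add: add_nonneg_pos)
  ultimately have "?e \<in> prokhorov_admissible \<mu> \<nu>" by (simp add: prokhorov_admissible_def)
  then show ?thesis by blast
qed

lemma prokhorov_dist_nonneg:
  assumes "finite_borel_measure \<mu>" "finite_borel_measure \<nu>"
  shows "0 \<le> prokhorov_dist \<mu> \<nu>"
  unfolding prokhorov_dist_eq_Inf
  by (rule cInf_greatest[OF prokhorov_admissible_nonempty[OF assms]])
     (simp add: prokhorov_admissible_def)

lemma prokhorov_dist_commute: "prokhorov_dist \<mu> \<nu> = prokhorov_dist \<nu> \<mu>"
  unfolding prokhorov_dist_def by (simp only: conj_commute)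

text \<open>Admissible radii exist below every \<open>d + 1 / Suc n\<close>, and as \<open>n\<close>
  grows the thickenings of a compact \<open>K\<close> decrease to \<open>cthick K d\<close>. These
  thickenings are closed, so the completion in the definition drops out.\<close>

lemma measure_compact_le_prokhorov_dist:
  fixes \<mu> \<nu> :: "'a::metric_space measure"
  assumes \<mu>: "finite_borel_measure \<mu>" and \<nu>: "finite_borel_measure \<nu>" and K: "compact K"
  defines "d \<equiv> prokhorov_dist \<mu> \<nu>"
  shows "measure \<nu> K \<le> measure \<mu> (cthick K d) + d"
proof -
  note \<mu>' = finite_borel_measureD[OF \<mu>]
  interpret \<mu>: finite_measure \<mu> by fact
  have closed: "cthick K e \<in> sets \<mu>" for e
    using closed_cthick_compact[OF K] by (simp add: \<mu>')
  let ?d = "\<lambda>n. d + 1 / real (Suc n)"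
  have le: "measure \<nu> K \<le> measure \<mu> (cthick K (?d n)) + ?d n" for n
  proof -
    have "Inf (prokhorov_admissible \<mu> \<nu>) < ?d n"
      unfolding d_def prokhorov_dist_eq_Inf by simp
    then obtain e where e: "e \<in> prokhorov_admissible \<mu> \<nu>" "e < ?d n"
      using cInf_lessD[OF prokhorov_admissible_nonempty[OF \<mu> \<nu>]] by blast
    then have "measure \<nu> K \<le> measure \<mu> (cthick K e) + e"
      using compact_imp_closed[OF K] closed by (auto simp: prokhorov_admissible_def)
    also have "\<dots> \<le> measure \<mu> (cthick K (?d n)) + ?d n"
      using e(2) closed by (intro add_mono \<mu>.finite_measure_mono cthick_mono) auto
    finally show ?thesis .
  qed
  have lim: "?d \<longlonglongrightarrow> d + 0"
    using LIMSEQ_inverse_real_of_nat by (intro tendsto_intros) (simp add: inverse_eq_divide)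
  have "(\<lambda>n. measure \<mu> (cthick K (?d n))) \<longlonglongrightarrow> measure \<mu> (\<Inter>n. cthick K (?d n))"
  proof (rule \<mu>.finite_Lim_measure_decseq)
    show "decseq (\<lambda>n. cthick K (?d n))"
      by (intro antimonoI cthick_mono add_mono divide_left_mono) auto
  qed (use closed in auto)
  then have "(\<lambda>n. measure \<mu> (cthick K (?d n)) + ?d n) \<longlonglongrightarrow> measure \<mu> (cthick K d) + (d + 0)"
    unfolding INT_cthick_compact[OF K] using lim by (rule tendsto_add)
  from LIMSEQ_le_const[OF this, of "measure \<nu> K"] show ?thesis using le by auto
qed

lemma sets_dist_gt: "{(x :: 'a::{metric_space,second_countable_topology}, y). dist x y > e} \<in> sets borel"
proof -
  have "open {p :: 'a \<times> 'a. e < dist (fst p) (snd p)}"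
    by (intro open_Collect_less continuous_intros)
  then show ?thesis by (simp add: case_prod_unfold)
qed

section \<open>Couplings versus Prokhorov inequalities\<close>

text \<open>The budget: the first marginal is exact, the second differs from \<nu> by at most
  \<nu>(Z) - \<mu>(Z), and only the added mass, at most \<mu>(Z) - \<gamma>(Z), can lie off
  \<open>S\<close>. The sum is \<nu>(Z) - \<gamma>(Z), which Hall's theorem keeps below
  \<open>d\<close>.\<close>

lemma coupling_of_compact_bound:
  fixes \<mu> \<nu> :: "'a::polish_space measure"
  assumes \<mu>: "finite_borel_measure \<mu>" and \<nu>: "finite_borel_measure \<nu>"
    and mass: "measure \<mu> UNIV \<le> measure \<nu> UNIV" and d: "0 \<le> d"
    and cpt: "\<And>K. compact K \<Longrightarrow> measure \<nu> K \<le> measure \<mu> (cthick K d) + d"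
  obtains \<alpha> where "finite_borel_measure \<alpha>" "coupling_ok \<alpha> \<mu> \<nu> d" "distr \<alpha> borel fst = \<mu>"
    "\<And>B. B \<in> sets borel \<Longrightarrow> measure (distr \<alpha> borel snd) B \<le> measure \<nu> B"
proof -
  note \<mu>' = finite_borel_measureD[OF \<mu>] and \<nu>' = finite_borel_measureD[OF \<nu>]
  interpret \<mu>: finite_measure \<mu> by fact
  interpret \<nu>: finite_measure \<nu> by fact
  define S where "S = {p :: 'a \<times> 'a. dist (fst p) (snd p) \<le> d}"
  have "closed S" unfolding S_def by (intro closed_Collect_le continuous_intros)
  \<comment> \<open>Inner regularity replaces \<open>B\<close> by a compact \<open>K\<close>, whose
    thickening consists of \<open>S\<close>-partners of \<open>K\<close> and so lies in
    \<open>U\<close>.\<close>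
  have hall: "measure \<nu> B \<le> measure \<mu> U + d"
    if B: "B \<in> sets borel" and U: "U \<in> sets borel" "{x. \<exists>y\<in>B. (x, y) \<in> S} \<subseteq> U" for B U
  proof (rule field_le_epsilon)
    fix e :: real assume "0 < e"
    then obtain K where K: "compact K" "K \<subseteq> B" "measure \<nu> (B - K) \<le> e"
      by (rule compact_inner_approx[OF \<nu> B])
    have "measure \<nu> (B - K) = measure \<nu> B - measure \<nu> K"
      using B K by (intro \<nu>.finite_measure_Diff) (auto simp: \<nu>' borel_compact)
    moreover have "cthick K d \<subseteq> U" using K(2) U(2) by (auto simp: cthick_def S_def)
    then have "measure \<mu> (cthick K d) \<le> measure \<mu> U"
      using U(1) by (intro \<mu>.finite_measure_mono) (auto simp: \<mu>')
    ultimately show "measure \<nu> B \<le> measure \<mu> U + d + e"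
      using K(3) cpt[OF K(1)] by linarith
  qed
  obtain \<gamma> where \<gamma>: "finite_borel_measure \<gamma>" "measure \<gamma> (- S) = 0" "measure \<nu> UNIV - d \<le> measure \<gamma> UNIV"
    "\<And>A. A \<in> sets borel \<Longrightarrow> measure \<gamma> (A \<times> UNIV) \<le> measure \<mu> A"
    "\<And>B. B \<in> sets borel \<Longrightarrow> measure \<gamma> (UNIV \<times> B) \<le> measure \<nu> B"
    using partial_coupling_on_closed_relation[OF \<mu> \<nu> d \<open>closed S\<close> hall] by blast
  obtain \<alpha> where \<alpha>: "finite_borel_measure \<alpha>" "distr \<alpha> borel fst = \<mu>"
    "\<And>B. B \<in> sets borel \<Longrightarrow> measure (distr \<alpha> borel snd) B \<le> measure \<nu> B"
    "\<And>T. T \<in> sets borel \<Longrightarrow> measure \<alpha> T \<le> measure \<gamma> T + (measure \<mu> UNIV - measure \<gamma> UNIV)"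
    using partial_coupling_completion[OF \<mu> \<nu> mass \<gamma>(1,4,5)] by blast
  have "{(x, y). dist x y > d} = - S" by (auto simp: S_def)
  then have "measure \<alpha> {(x, y). dist x y > d} \<le> measure \<mu> UNIV - measure \<gamma> UNIV"
    using \<alpha>(4)[OF sets_dist_gt[of d]] \<gamma>(2) by simp
  moreover have "tv_dist (distr \<alpha> borel snd) \<nu> \<le> measure \<nu> UNIV - measure \<mu> UNIV"
  proof -
    have "measure (distr \<alpha> borel snd) UNIV = measure (distr \<alpha> borel fst) UNIV"
      by (simp add: measure_distr_fst_snd[OF \<alpha>(1)])
    then show ?thesis
      using tv_dist_le_mass_diff[OF finite_borel_measure_marginals(2)[OF \<alpha>(1)] \<nu> \<alpha>(3)] \<alpha>(2) by simp
  qed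
  ultimately have "coupling_ok \<alpha> \<mu> \<nu> d"
    using \<gamma>(3) by (simp add: coupling_ok_def discrepancy_def \<alpha>(2))
  then show thesis using \<alpha> by (intro that)
qed

lemma coupling_ok_mono:
  fixes \<alpha> :: "('a::{metric_space,second_countable_topology} \<times> 'a) measure"
  assumes \<alpha>: "finite_borel_measure \<alpha>" "coupling_ok \<alpha> \<mu> \<nu> d" "d \<le> e"
  shows "coupling_ok \<alpha> \<mu> \<nu> e"
proof -
  interpret finite_measure \<alpha> using \<alpha> by (simp add: finite_borel_measure_def)
  have "measure \<alpha> {(x, y). dist x y > e} \<le> measure \<alpha> {(x, y). dist x y > d}"
    using \<alpha>(3) sets_dist_gt finite_borel_measureD(2)[OF \<alpha>(1)] by (intro finite_measure_mono) auto
  then show ?thesis using \<alpha>(2,3) by (simp add: coupling_ok_def)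
qed

text \<open>Gives the second Prokhorov inequality from the first, and the case in which \<mu> has
  the larger mass from the opposite one.\<close>

lemma coupling_ok_swap:
  fixes \<alpha> :: "('a::{metric_space,second_countable_topology} \<times> 'a) measure"
  assumes \<alpha>: "finite_borel_measure \<alpha>" "coupling_ok \<alpha> \<mu> \<nu> e"
  defines "\<alpha>' \<equiv> distr \<alpha> borel prod.swap"
  shows "finite_borel_measure \<alpha>'" "coupling_ok \<alpha>' \<nu> \<mu> e"
proof -
  have sw: "(prod.swap :: 'a \<times> 'a \<Rightarrow> 'a \<times> 'a) \<in> borel_measurable borel"
    by (intro borel_measurable_continuous_onI) (auto simp: prod.swap_def intro!: continuous_intros)
  have pr: "(fst :: 'a \<times> 'a \<Rightarrow> 'a) \<in> borel_measurable borel" "(snd :: 'a \<times> 'a \<Rightarrow> 'a) \<in> borel_measurable borel"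
    by (auto intro!: borel_measurable_continuous_onI continuous_intros)
  note \<alpha>'' = finite_borel_measureD[OF \<alpha>(1)]
  have sw': "prod.swap \<in> measurable \<alpha> borel"
    using sw measurable_cong_sets[OF \<alpha>''(2) refl] by blast
  show "finite_borel_measure \<alpha>'" unfolding \<alpha>'_def by (rule finite_borel_measure_distr[OF \<alpha>(1) sw])
  have "distr \<alpha>' borel fst = distr \<alpha> borel snd" "distr \<alpha>' borel snd = distr \<alpha> borel fst"
    unfolding \<alpha>'_def using pr sw' by (simp_all add: distr_distr comp_def)
  moreover have "measure \<alpha>' {(x, y). dist x y > e} = measure \<alpha> {(x, y). dist x y > e}"
  proof -
    have "prod.swap -` {(x, y). dist x y > e} = {(x :: 'a, y). dist x y > e}"
      by (auto simp: dist_commute)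
    then show ?thesis
      unfolding \<alpha>'_def by (simp add: measure_distr[OF sw' sets_dist_gt] \<alpha>'')
  qed
  ultimately show "coupling_ok \<alpha>' \<nu> \<mu> e"
    using \<alpha>(2) by (simp add: coupling_ok_def discrepancy_def)
qed

text \<open>If \<open>x\<close> is in \<open>A\<close>, then \<open>y\<close> lies in the thickening
  or \<open>dist x y > e\<close>; each replacement of a marginal by \<mu> or \<nu> costs its share
  of the discrepancy. Total variation tests Borel sets only, so the thickening is first enlarged to
  a Borel set \<open>B\<close> of the same completed measure.\<close>

lemma coupling_imp_measure_closed_le:
  fixes \<mu> \<nu> :: "'a::polish_space measure"
  assumes \<mu>: "finite_borel_measure \<mu>" and \<nu>: "finite_borel_measure \<nu>"
    and \<alpha>: "finite_borel_measure \<alpha>" "coupling_ok \<alpha> \<mu> \<nu> e" and A: "closed A"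
  shows "measure \<mu> A \<le> measure (completion \<nu>) (cthick A e) + e"
proof -
  note \<nu>' = finite_borel_measureD[OF \<nu>] and \<alpha>' = finite_borel_measureD[OF \<alpha>(1)]
  interpret \<alpha>: finite_measure \<alpha> by fact
  obtain B where B: "B \<in> sets \<nu>" "cthick A e \<subseteq> B" "emeasure (completion \<nu>) (cthick A e) = emeasure \<nu> B"
    using completion_upper[OF cthick_in_completion[OF \<nu> A]] by blast
  have B': "B \<in> sets borel" using B(1) \<nu>' by simp
  have A': "A \<in> sets borel" using A by simp
  let ?D = "{(x, y). dist x y > e} :: ('a \<times> 'a) set"
  have D: "?D \<in> sets borel" by (rule sets_dist_gt)
  have "measure \<mu> A \<le> measure \<alpha> (A \<times> UNIV) + tv_dist (distr \<alpha> borel fst) \<mu>"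
    using abs_measure_diff_le_tv_dist[OF finite_borel_measure_marginals(1)[OF \<alpha>(1)] \<mu> A']
    by (simp add: measure_distr_fst_snd[OF \<alpha>(1) A'])
  moreover have "measure \<alpha> (A \<times> UNIV) \<le> measure \<alpha> (UNIV \<times> B) + measure \<alpha> ?D"
  proof -
    have "A \<times> UNIV \<subseteq> UNIV \<times> B \<union> ?D"
      using B(2) by (force simp: cthick_def dist_commute not_less)
    then have "measure \<alpha> (A \<times> UNIV) \<le> measure \<alpha> (UNIV \<times> B \<union> ?D)"
      using B' D by (intro \<alpha>.finite_measure_mono) (simp_all add: \<alpha>' borel_Times sets.Un)
    also have "\<dots> \<le> measure \<alpha> (UNIV \<times> B) + measure \<alpha> ?D"
      using B' D by (intro measure_Un_le) (simp_all add: \<alpha>' borel_Times)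
    finally show ?thesis .
  qed
  moreover have "measure \<alpha> (UNIV \<times> B) \<le> measure \<nu> B + tv_dist (distr \<alpha> borel snd) \<nu>"
    using abs_measure_diff_le_tv_dist[OF finite_borel_measure_marginals(2)[OF \<alpha>(1)] \<nu> B']
    by (simp add: measure_distr_fst_snd[OF \<alpha>(1) B'])
  moreover have "measure (completion \<nu>) (cthick A e) = measure \<nu> B"
    using B(3) by (simp add: measure_def)
  ultimately show ?thesis using \<alpha>(2) by (simp add: coupling_ok_def discrepancy_def)
qed

text \<open>Admissible radii are positive whereas \<open>e\<close> may be 0, so the coupling is
  relaxed to an arbitrary \<open>e' > e\<close>.\<close>

lemma coupling_imp_prokhorov_dist_le:
  fixes \<mu> \<nu> :: "'a::polish_space measure"
  assumes \<mu>: "finite_borel_measure \<mu>" and \<nu>: "finite_borel_measure \<nu>" and "0 \<le> e"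
    and \<alpha>: "finite_borel_measure \<alpha>" "coupling_ok \<alpha> \<mu> \<nu> e"
  shows "prokhorov_dist \<mu> \<nu> \<le> e"
proof (rule dense_ge)
  fix e' assume e': "e < e'"
  then have ok: "coupling_ok \<alpha> \<mu> \<nu> e'" using coupling_ok_mono[OF \<alpha>] by simp
  note sw = coupling_ok_swap[OF \<alpha>(1) ok]
  have "e' \<in> prokhorov_admissible \<mu> \<nu>"
    unfolding prokhorov_admissible_def
    using e' \<open>0 \<le> e\<close> coupling_imp_measure_closed_le[OF \<mu> \<nu> \<alpha>(1) ok]
      coupling_imp_measure_closed_le[OF \<nu> \<mu> sw] by simp
  then show "prokhorov_dist \<mu> \<nu> \<le> e'"
    unfolding prokhorov_dist_eq_Inf by (rule cInf_lower[OF _ bdd_below_prokhorov_admissible])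
qed

lemma coupling_ok_prokhorov_dist:
  fixes \<mu> \<nu> :: "'a::polish_space measure"
  assumes \<mu>: "finite_borel_measure \<mu>" and \<nu>: "finite_borel_measure \<nu>"
    and mass: "measure \<mu> UNIV \<le> measure \<nu> UNIV"
  obtains \<alpha> where "finite_borel_measure \<alpha>" "coupling_ok \<alpha> \<mu> \<nu> (prokhorov_dist \<mu> \<nu>)"
    "distr \<alpha> borel fst = \<mu>" "\<And>B. B \<in> sets borel \<Longrightarrow> measure (distr \<alpha> borel snd) B \<le> measure \<nu> B"
  by (rule coupling_of_compact_bound[OF \<mu> \<nu> mass prokhorov_dist_nonneg[OF \<mu> \<nu>]
      measure_compact_le_prokhorov_dist[OF \<mu> \<nu>]]) (assumption, rule that)

lemma ex_coupling_ok_prokhorov_dist: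
  fixes \<mu> \<nu> :: "'a::polish_space measure"
  assumes \<mu>: "finite_borel_measure \<mu>" and \<nu>: "finite_borel_measure \<nu>"
  obtains \<alpha> where "finite_borel_measure \<alpha>" "coupling_ok \<alpha> \<mu> \<nu> (prokhorov_dist \<mu> \<nu>)"
proof (cases "measure \<mu> UNIV \<le> measure \<nu> UNIV")
  case True
  then show thesis using coupling_ok_prokhorov_dist[OF \<mu> \<nu>] that by blast
next
  case False
  then have "measure \<nu> UNIV \<le> measure \<mu> UNIV" by simp
  then obtain \<alpha> where \<alpha>: "finite_borel_measure \<alpha>" "coupling_ok \<alpha> \<nu> \<mu> (prokhorov_dist \<nu> \<mu>)"
    using coupling_ok_prokhorov_dist[OF \<nu> \<mu>] by blast
  from coupling_ok_swap[OF this] show thesis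
    using that prokhorov_dist_commute[of \<mu> \<nu>] by simp
qed

text \<open>Concentration on the supports is not built into the coupling: it is forced by domination
  of both marginals, since a point outside the product has a coordinate in a null set.\<close>

lemma marginals_le_imp_null_outside_supports:
  fixes \<mu> \<nu> :: "'a::polish_space measure"
  assumes \<mu>: "finite_borel_measure \<mu>" and \<nu>: "finite_borel_measure \<nu>" and \<alpha>: "finite_borel_measure \<alpha>"
    and fst: "\<And>A. A \<in> sets borel \<Longrightarrow> measure (distr \<alpha> borel fst) A \<le> measure \<mu> A"
    and snd: "\<And>B. B \<in> sets borel \<Longrightarrow> measure (distr \<alpha> borel snd) B \<le> measure \<nu> B"
  shows "emeasure \<alpha> (UNIV - msupp \<mu> \<times> msupp \<nu>) = 0"
proof -
  note \<mu>' = finite_borel_measureD[OF \<mu>] and \<nu>' = finite_borel_measureD[OF \<nu>] and \<alpha>' = finite_borel_measureD[OF \<alpha>]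
  interpret \<alpha>: finite_measure \<alpha> by fact
  have s: "- msupp \<mu> \<in> sets borel" "- msupp \<nu> \<in> sets borel"
    using Compl_msupp_null[OF \<mu>] Compl_msupp_null[OF \<nu>] \<mu>' \<nu>' by auto
  have "measure \<mu> (- msupp \<mu>) = 0" "measure \<nu> (- msupp \<nu>) = 0"
    using Compl_msupp_null[OF \<mu>] Compl_msupp_null[OF \<nu>] by (simp_all add: measure_def null_setsD1)
  then have "measure \<alpha> ((- msupp \<mu>) \<times> UNIV) = 0" "measure \<alpha> (UNIV \<times> (- msupp \<nu>)) = 0"
    using fst[OF s(1)] snd[OF s(2)]
    by (simp_all add: measure_distr_fst_snd[OF \<alpha>] s measure_le_0_iff)
  then have "(- msupp \<mu>) \<times> UNIV \<in> null_sets \<alpha>" "UNIV \<times> (- msupp \<nu>) \<in> null_sets \<alpha>"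
    using s by (simp_all add: null_sets_def \<alpha>' borel_Times \<alpha>.emeasure_eq_measure)
  then have "(- msupp \<mu>) \<times> UNIV \<union> UNIV \<times> (- msupp \<nu>) \<in> null_sets \<alpha>" by (rule null_sets.Un)
  moreover have "UNIV - msupp \<mu> \<times> msupp \<nu> = (- msupp \<mu>) \<times> UNIV \<union> UNIV \<times> (- msupp \<nu>)" by auto
  ultimately show ?thesis by (simp add: null_setsD1)
qed

theorem theorem2p1:
  fixes \<mu> \<nu> :: "'a::polish_space measure"
  assumes "finite_borel_measure \<mu>" and "finite_borel_measure \<nu>"
  shows "(\<forall>e\<ge>0. prokhorov_dist \<mu> \<nu> \<le> e \<longleftrightarrow>
            (\<exists>\<alpha>::('a \<times> 'a) measure. finite_borel_measure \<alpha> \<and> coupling_ok \<alpha> \<mu> \<nu> e))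
       \<and> (prokhorov_dist \<mu> \<nu> \<in> {e. e \<ge> 0 \<and>
              (\<exists>\<alpha>::('a \<times> 'a) measure. finite_borel_measure \<alpha> \<and> coupling_ok \<alpha> \<mu> \<nu> e)}
          \<and> (\<forall>e\<in>{e. e \<ge> 0 \<and>
              (\<exists>\<alpha>::('a \<times> 'a) measure. finite_borel_measure \<alpha> \<and> coupling_ok \<alpha> \<mu> \<nu> e)}.
                prokhorov_dist \<mu> \<nu> \<le> e))
       \<and> (measure \<mu> (space \<mu>) \<le> measure \<nu> (space \<nu>) \<longrightarrow>
            (\<exists>\<alpha>::('a \<times> 'a) measure. finite_borel_measure \<alpha>
               \<and> coupling_ok \<alpha> \<mu> \<nu> (prokhorov_dist \<mu> \<nu>)
               \<and> distr \<alpha> borel fst = \<mu>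
               \<and> (\<forall>A\<in>sets borel. measure (distr \<alpha> borel snd) A \<le> measure \<nu> A)
               \<and> emeasure \<alpha> (UNIV - msupp \<mu> \<times> msupp \<nu>) = 0))"
proof -
  let ?d = "prokhorov_dist \<mu> \<nu>"
  let ?ok = "\<lambda>e. \<exists>\<alpha>::('a \<times> 'a) measure. finite_borel_measure \<alpha> \<and> coupling_ok \<alpha> \<mu> \<nu> e"
  have upper: "?d \<le> e" if "0 \<le> e" "?ok e" for e
    using coupling_imp_prokhorov_dist_le[OF assms that(1)] that(2) by blast
  have "?ok ?d" using ex_coupling_ok_prokhorov_dist[OF assms] by blast
  then have lower: "?ok e" if "?d \<le> e" for e
    using coupling_ok_mono[OF _ _ that] by blast
  have iii: "\<exists>\<alpha>::('a \<times> 'a) measure. finite_borel_measure \<alpha> \<and> coupling_ok \<alpha> \<mu> \<nu> ?d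
      \<and> distr \<alpha> borel fst = \<mu> \<and> (\<forall>A\<in>sets borel. measure (distr \<alpha> borel snd) A \<le> measure \<nu> A)
      \<and> emeasure \<alpha> (UNIV - msupp \<mu> \<times> msupp \<nu>) = 0"
    if "measure \<mu> (space \<mu>) \<le> measure \<nu> (space \<nu>)"
  proof -
    have "measure \<mu> UNIV \<le> measure \<nu> UNIV"
      using that finite_borel_measureD(3)[OF assms(1)] finite_borel_measureD(3)[OF assms(2)] by simp
    then obtain \<alpha> where \<alpha>: "finite_borel_measure \<alpha>" "coupling_ok \<alpha> \<mu> \<nu> ?d" "distr \<alpha> borel fst = \<mu>"
      "\<And>B. B \<in> sets borel \<Longrightarrow> measure (distr \<alpha> borel snd) B \<le> measure \<nu> B"
      using coupling_ok_prokhorov_dist[OF assms] by blast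
    moreover have "emeasure \<alpha> (UNIV - msupp \<mu> \<times> msupp \<nu>) = 0"
      using \<alpha>(3,4) by (intro marginals_le_imp_null_outside_supports[OF assms \<alpha>(1)]) auto
    ultimately show ?thesis by blast
  qed
  show ?thesis
  proof (intro conjI allI impI ballI iffI)
    show "?d \<in> {e. e \<ge> 0 \<and> ?ok e}" using \<open>?ok ?d\<close> prokhorov_dist_nonneg[OF assms] by blast
    show "?d \<le> e" if "e \<in> {e. e \<ge> 0 \<and> ?ok e}" for e using that upper by blast
  qed (auto intro: upper lower iii)
qed

end
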